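(* Let $\mathcal P$ be a feasible graph parameter. For the relevant integers $n,s$ put $H_{n,s}=K_s\vee(sK_1\cup K_{n-2s})$ and $L_{n,s}=K_{s-1}\vee(sK_1\cup K_{n-2s+1})$. The following statements hold. (i) If $k\ge1$ and $n\ge2k+1$ are integers, then $$\mathrm{ex}_{\mathcal P}(n,C_n;\delta\ge k)=\max_{k\le s\le\lfloor(n-1)/2\rfloor}\mathcal P(H_{n,s}),$$ and $$\mathrm{EX}_{\mathcal P}(n,C_n;\delta\ge k)=\left\{H_{n,s}: k\le s\le\lfloor(n-1)/2\rfloor,\ \mathcal P(H_{n,s})=\mathrm{ex}_{\mathcal P}(n,C_n;\delta\ge k)\right\}.$$ (ii) If $k\ge1$ and $n\ge2k+2$ are integers, then $$\mathrm{ex}_{\mathcal P}(n,P_n;\delta\ge k)=\max_{k+1\le s\le\lfloor n/2\rfloor}\mathcal P(L_{n,s}),$$ and $$\mathrm{EX}_{\mathcal P}(n,P_n;\delta\ge k)=\left\{L_{n,s}: k+1\le s\le\lfloor n/2\rfloor,\ \mathcal P(L_{n,s})=\mathrm{ex}_{\mathcal P}(n,P_n;\delta\ge k)\right\}.$$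
   Context: All graphs are finite and simple; graph equality is up to isomorphism. A graph parameter is a real-valued isomorphism invariant of graphs. $H_1\cup H_2$ denotes disjoint union and $H_1\vee H_2$ denotes join (disjoint union plus all edges between the two graphs); $sK_1$ is the edgeless graph on $s$ vertices. $\delta$ is the minimum degree. $C_n$ and $P_n$ are the cycle and the path with $n$ vertices. Kelmans operation: for distinct vertices $x,y$ of a graph $G$, let $W=N_G(x)\setminus N_G[y]$, where $N_G[y]=N_G(y)\cup\{y\}$, and let $G[x\to y]=G-\{xw:w\in W\}+\{yw:w\in W\}$. A graph parameter $\mathcal P$ is feasible if for every graph $G$ (connected or not): (P1) $\mathcal P(G+F)>\mathcal P(G)$ for every nonempty set $F\subseteq\binom{V(G)}2\setminus E(G)$ such that $G+F$ is connected, where $G+F$ has vertex set $V(G)$ and edge set $E(G)\cup F$; (P2) $\mathcal P(G[x\to y])\ge\mathcal P(G)$ for every ordered pair of distinct vertices $x,y\in V(G)$. For a graph $F$, $\mathrm{ex}_{\mathcal P}(n,F;\delta\ge k)$ is the maximum of $\mathcal P$ over all graphs of order $n$ and minimum degree at least $k$ that contain no copy of $F$ (as a subgraph), and $\mathrm{EX}_{\mathcal P}(n,F;\delta\ge k)$ is the family of all such graphs (up to isomorphism) attaining this maximum. *)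

theory Defs
  imports Complex_Main "HOL-Library.Ramsey" "HOL-Library.Nat_Bijection"
begin

section \<open>Finite simple graphs\<close>

datatype 'a graph = Graph (verts: "'a set") (edges: "'a set set")

definition simple_graph :: "'a graph \<Rightarrow> bool" where
  "simple_graph G \<longleftrightarrow> finite (verts G) \<and> edges G \<subseteq> [verts G]\<^bsup>2\<^esup>"

definition neighbors :: "'a graph \<Rightarrow> 'a \<Rightarrow> 'a set" where
  "neighbors G x = {y. {x, y} \<in> edges G}"

definition degree :: "'a graph \<Rightarrow> 'a \<Rightarrow> nat" where
  "degree G x = card (neighbors G x)"

definition min_degree :: "'a graph \<Rightarrow> nat" where
  "min_degree G = Min (degree G ` verts G)"

definition connected_graph :: "'a graph \<Rightarrow> bool" where
  "connected_graph G \<longleftrightarrow> verts G \<noteq> {} \<and>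
     (\<forall>x \<in> verts G. \<forall>y \<in> verts G. (x, y) \<in> {(u, v). {u, v} \<in> edges G}\<^sup>*)"

definition graph_iso :: "'a graph \<Rightarrow> 'b graph \<Rightarrow> bool" where
  "graph_iso G H \<longleftrightarrow> (\<exists>f. bij_betw f (verts G) (verts H) \<and>
     (\<forall>x \<in> verts G. \<forall>y \<in> verts G. {x, y} \<in> edges G \<longleftrightarrow> {f x, f y} \<in> edges H))"

text \<open>The isomorphism type of a graph; equality of isomorphism types is equality up to isomorphism.\<close>

definition iso_class :: "'a graph \<Rightarrow> 'a graph set" where
  "iso_class G = {H. simple_graph H \<and> graph_iso G H}"

definition contains_copy :: "'a graph \<Rightarrow> 'b graph \<Rightarrow> bool" where
  "contains_copy G F \<longleftrightarrow> (\<exists>f. inj_on f (verts F) \<and> f ` verts F \<subseteq> verts G \<and>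
     (\<forall>e \<in> edges F. f ` e \<in> edges G))"

section \<open>Constructions\<close>

definition map_verts :: "('a \<Rightarrow> 'b) \<Rightarrow> 'a graph \<Rightarrow> 'b graph" where
  "map_verts f G = Graph (f ` verts G) ((`) f ` edges G)"

text \<open>All graphs below have natural numbers as vertices, which covers every finite graph up to
  isomorphism. To form a disjoint union or a join, the two vertex sets are first made disjoint by
  the injections \<open>v \<mapsto> sum_encode (Inl v) = 2 * v\<close> and
  \<open>v \<mapsto> sum_encode (Inr v) = 2 * v + 1\<close>.\<close>

definition disjoint_union :: "nat graph \<Rightarrow> nat graph \<Rightarrow> nat graph" where
  "disjoint_union G H =
     (let G' = map_verts (\<lambda>v. sum_encode (Inl v)) G; H' = map_verts (\<lambda>v. sum_encode (Inr v)) H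
      in Graph (verts G' \<union> verts H') (edges G' \<union> edges H'))"

definition join :: "nat graph \<Rightarrow> nat graph \<Rightarrow> nat graph" where
  "join G H =
     (let G' = map_verts (\<lambda>v. sum_encode (Inl v)) G; H' = map_verts (\<lambda>v. sum_encode (Inr v)) H
      in Graph (verts G' \<union> verts H')
           (edges G' \<union> edges H' \<union> {{x, y} |x y. x \<in> verts G' \<and> y \<in> verts H'}))"

definition complete_graph :: "nat \<Rightarrow> nat graph" where
  "complete_graph n = Graph {..<n} ([{..<n}]\<^bsup>2\<^esup>)"

definition edgeless_graph :: "nat \<Rightarrow> nat graph" where
  "edgeless_graph s = Graph {..<s} {}"

text \<open>Only meaningful for \<open>n \<ge> 3\<close>.\<close>

definition cycle_graph :: "nat \<Rightarrow> nat graph" where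
  "cycle_graph n = Graph {..<n} {{i, (i + 1) mod n} |i. i < n}"

definition path_graph :: "nat \<Rightarrow> nat graph" where
  "path_graph n = Graph {..<n} {{i, i + 1} |i. i + 1 < n}"

text \<open>In both families natural-number subtraction does not truncate in the relevant ranges
  \<open>s \<le> (n - 1) div 2\<close> and \<open>1 \<le> s \<le> n div 2\<close>, respectively.\<close>

definition H_graph :: "nat \<Rightarrow> nat \<Rightarrow> nat graph" where
  "H_graph n s =
     join (complete_graph s) (disjoint_union (edgeless_graph s) (complete_graph (n - 2 * s)))"

definition L_graph :: "nat \<Rightarrow> nat \<Rightarrow> nat graph" where
  "L_graph n s =
     join (complete_graph (s - 1))
       (disjoint_union (edgeless_graph s) (complete_graph (n + 1 - 2 * s)))"

definition add_edges :: "'a graph \<Rightarrow> 'a set set \<Rightarrow> 'a graph" where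
  "add_edges G F = Graph (verts G) (edges G \<union> F)"

definition kelmans :: "'a graph \<Rightarrow> 'a \<Rightarrow> 'a \<Rightarrow> 'a graph" where
  "kelmans G x y =
     (let W = neighbors G x - (neighbors G y \<union> {y})
      in Graph (verts G) ((edges G - {{x, w} |w. w \<in> W}) \<union> {{y, w} |w. w \<in> W}))"

section \<open>Graph parameters and the extremal problem\<close>

definition graph_parameter :: "(nat graph \<Rightarrow> real) \<Rightarrow> bool" where
  "graph_parameter P \<longleftrightarrow>
     (\<forall>G H. simple_graph G \<longrightarrow> simple_graph H \<longrightarrow> graph_iso G H \<longrightarrow> P G = P H)"

definition feasible :: "(nat graph \<Rightarrow> real) \<Rightarrow> bool" where
  "feasible P \<longleftrightarrow> (\<forall>G. simple_graph G \<longrightarrow>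
     (\<forall>F. F \<noteq> {} \<longrightarrow> F \<subseteq> [verts G]\<^bsup>2\<^esup> - edges G \<longrightarrow> connected_graph (add_edges G F) \<longrightarrow>
        P (add_edges G F) > P G) \<and>
     (\<forall>x \<in> verts G. \<forall>y \<in> verts G. x \<noteq> y \<longrightarrow> P (kelmans G x y) \<ge> P G))"

definition free_graphs :: "nat \<Rightarrow> nat graph \<Rightarrow> nat \<Rightarrow> nat graph set" where
  "free_graphs n F k =
     {G. simple_graph G \<and> card (verts G) = n \<and> min_degree G \<ge> k \<and> \<not> contains_copy G F}"

text \<open>The set \<open>P ` free_graphs n F k\<close> is finite for every graph parameter (proved below), so
  the maximum is a genuine one as soon as \<open>free_graphs n F k\<close> is nonempty.\<close>

definition ex_param :: "(nat graph \<Rightarrow> real) \<Rightarrow> nat \<Rightarrow> nat graph \<Rightarrow> nat \<Rightarrow> real" where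
  "ex_param P n F k = Max (P ` free_graphs n F k)"

definition EX_param :: "(nat graph \<Rightarrow> real) \<Rightarrow> nat \<Rightarrow> nat graph \<Rightarrow> nat \<Rightarrow> nat graph set set" where
  "EX_param P n F k = {iso_class G |G. G \<in> free_graphs n F k \<and> P G = ex_param P n F k}"

lemma finite_param_free_graphs:
  assumes "graph_parameter P"
  shows "finite (P ` free_graphs n F k)"
proof -
  let ?S = "(\<lambda>(V, E). Graph V E) ` ({{..<n}} \<times> Pow ([{..<n}]\<^bsup>2\<^esup>))"
  have "P ` free_graphs n F k \<subseteq> P ` ?S"
  proof
    fix r assume "r \<in> P ` free_graphs n F k"
    then obtain G where G: "simple_graph G" "card (verts G) = n" "r = P G"
      by (auto simp: free_graphs_def)
    then obtain f where f: "bij_betw f (verts G) {..<n}"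
      using ex_bij_betw_finite_nat[of "verts G"] by (auto simp: simple_graph_def atLeast0LessThan)
    then have inj: "inj_on f (verts G)" and im: "f ` verts G = {..<n}"
      by (auto simp: bij_betw_def)
    have sub: "edges G \<subseteq> Pow (verts G)"
      using G(1) by (auto simp: simple_graph_def nsets_def)
    have E: "(`) f ` edges G \<subseteq> [{..<n}]\<^bsup>2\<^esup>"
    proof
      fix e' assume "e' \<in> (`) f ` edges G"
      then obtain e where e: "e \<in> edges G" "e' = f ` e" by auto
      then have "e \<subseteq> verts G" "card e = 2" "finite e"
        using G(1) by (auto simp: simple_graph_def nsets_def)
      then show "e' \<in> [{..<n}]\<^bsup>2\<^esup>"
        using e im inj_on_subset[OF inj, of e] by (auto simp: nsets_def card_image)
    qed
    have "{x, y} \<in> edges G \<longleftrightarrow> {f x, f y} \<in> (`) f ` edges G"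
      if "x \<in> verts G" "y \<in> verts G" for x y
    proof -
      have "f ` {x, y} \<in> (`) f ` edges G \<longleftrightarrow> {x, y} \<in> edges G"
        by (rule inj_on_image_mem_iff[OF inj_on_image_Pow[OF inj]]) (use that sub in auto)
      then show ?thesis by simp
    qed
    then have "graph_iso G (map_verts f G)"
      using f im by (auto simp: graph_iso_def map_verts_def intro!: exI[of _ f])
    moreover have "simple_graph (map_verts f G)"
      using im E by (simp add: simple_graph_def map_verts_def)
    ultimately have "r = P (map_verts f G)"
      using assms G by (auto simp: graph_parameter_def)
    moreover have "map_verts f G \<in> ?S"
      using im E by (auto simp: map_verts_def)
    ultimately show "r \<in> P ` ?S" by blast
  qed
  moreover have "finite (P ` ?S)"
    by (intro finite_imageI finite_cartesian_product) (auto simp: finite_imp_finite_nsets)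
  ultimately show ?thesis by (rule finite_subset)
qed

end

theory Submission
  imports Defs
begin

text \<open>As in Chvatal's degree theorem, a non-Hamiltonian graph on \<open>n\<close> vertices has a set \<open>A\<close> of \<open>s\<close>
  vertices of degree at most \<open>s\<close>, where \<open>\<delta> \<le> s < n / 2\<close>. Kelmans operations whose target lies
  outside \<open>A\<close> do not raise a degree in \<open>A\<close>, and iterating them turns the graph into a spanning subgraph of a copy of
  \<open>H_graph n s\<close>; so feasibility bounds the parameter by its value on \<open>H_graph n s\<close>.
  In the case of equality the last graph is \<open>H_graph n s\<close> itself. All graphs on the way are
  non-Hamiltonian, and a non-Hamiltonian graph that a Kelmans operation turns into \<open>H_graph n s\<close>
  is already isomorphic to it, so equality propagates back to the start.
  Adding a dominating vertex reduces paths to cycles.\<close>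

section \<open>Adjacency\<close>

text \<open>Only the first feasibility axiom is strict, and it acts just once, between the last
  graph \<open>M\<close> and the split graph containing it. The Kelmans axiom is weak, so equality
  along the sequence says nothing about the graphs themselves and the extremal shape has to be
  pulled back combinatorially. If the neighbourhoods of \<open>x\<close> and \<open>y\<close> are
  nested up to \<open>x\<close> and \<open>y\<close> themselves, the operation is the identity or
  amounts to exchanging \<open>x\<close> and \<open>y\<close>. Otherwise each of them has a private
  neighbour, and then the graph before the operation has a Hamilton cycle; this is the longest case
  analysis.

  For paths the result on cycles cannot simply be applied to the graph with a dominating vertex
  added, since nothing relates the parameter of the enlarged graph to that of the original. The cone
  serves only the combinatorial side, and every Kelmans operation that the parameter sees takes
  place in the original graph. Hence the comparison is stated for an abstract invariant
  \<open>N\<close> and independent sizes \<open>t\<close> and \<open>a\<close>, namely (s, s) for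
  cycles and (s - 1, s) for paths.\<close>

abbreviation adj :: "'a graph \<Rightarrow> 'a \<Rightarrow> 'a \<Rightarrow> bool" where
  "adj G u v \<equiv> {u, v} \<in> edges G"

lemma adj_sym: "adj G u v \<longleftrightarrow> adj G v u"
  by (simp add: insert_commute)

lemma adjD:
  assumes "simple_graph G" "adj G u v"
  shows "u \<in> verts G" "v \<in> verts G" "u \<noteq> v"
  using assms by (auto simp: simple_graph_def nsets_def card_insert_if split: if_splits)

lemma edge_pair:
  assumes "simple_graph G" "e \<in> edges G"
  obtains u v where "e = {u, v}" "u \<in> verts G" "v \<in> verts G" "u \<noteq> v"
proof -
  have "e \<subseteq> verts G" "card e = 2"
    using assms by (auto simp: simple_graph_def nsets_def)
  then show ?thesis
    using that by (auto simp: card_2_iff)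
qed

lemma simple_graphI:
  assumes "finite (verts G)"
    and "\<And>e. e \<in> edges G \<Longrightarrow> \<exists>u v. e = {u, v} \<and> u \<in> verts G \<and> v \<in> verts G \<and> u \<noteq> v"
  shows "simple_graph G"
proof -
  have "e \<in> [verts G]\<^bsup>2\<^esup>" if e: "e \<in> edges G" for e
  proof -
    obtain u v where "e = {u, v}" "u \<in> verts G" "v \<in> verts G" "u \<noteq> v"
      using assms(2)[OF e] by blast
    then show ?thesis
      by (simp add: nsets_def)
  qed
  then show ?thesis
    using assms(1) by (auto simp: simple_graph_def)
qed

lemma edges_subsetI:
  assumes "simple_graph G" "\<And>u v. adj G u v \<Longrightarrow> adj H u v"
  shows "edges G \<subseteq> edges H"
proof
  fix e assume "e \<in> edges G"
  then obtain u v where "e = {u, v}" "adj G u v"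
    using edge_pair[OF assms(1)] by metis
  then show "e \<in> edges H"
    using assms(2) by simp
qed

lemma neighbors_subset: "simple_graph G \<Longrightarrow> neighbors G v \<subseteq> verts G"
  using adjD(2) by (fastforce simp: neighbors_def)

lemma finite_neighbors: "simple_graph G \<Longrightarrow> finite (neighbors G v)"
  using neighbors_subset finite_subset by (fastforce simp: simple_graph_def)

lemma degree_le_card:
  assumes "simple_graph G"
  shows "degree G v \<le> card (verts G)"
  unfolding degree_def
  using assms neighbors_subset[OF assms] by (simp add: simple_graph_def card_mono)

section \<open>Isomorphism as an equivalence relation\<close>

lemma graph_iso_sym:
  assumes "graph_iso G H"
  shows "graph_iso H G"
proof -
  obtain f where f: "bij_betw f (verts G) (verts H)"
    and e: "\<forall>x \<in> verts G. \<forall>y \<in> verts G. adj G x y \<longleftrightarrow> adj H (f x) (f y)"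
    using assms by (auto simp: graph_iso_def)
  let ?g = "inv_into (verts G) f"
  have "bij_betw ?g (verts H) (verts G)"
    using f by (rule bij_betw_inv_into)
  moreover have "adj H x y \<longleftrightarrow> adj G (?g x) (?g y)" if "x \<in> verts H" "y \<in> verts H" for x y
  proof -
    have "?g x \<in> verts G" "?g y \<in> verts G" "f (?g x) = x" "f (?g y) = y"
      using that f by (auto simp: bij_betw_def f_inv_into_f inv_into_into)
    then show ?thesis
      using e by auto
  qed
  ultimately show ?thesis
    unfolding graph_iso_def by blast
qed

lemma graph_iso_trans:
  assumes "graph_iso G H" "graph_iso H J"
  shows "graph_iso G J"
proof -
  obtain f where f: "bij_betw f (verts G) (verts H)"
    "\<forall>x \<in> verts G. \<forall>y \<in> verts G. adj G x y \<longleftrightarrow> adj H (f x) (f y)"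
    using assms(1) by (auto simp: graph_iso_def)
  obtain g where g: "bij_betw g (verts H) (verts J)"
    "\<forall>x \<in> verts H. \<forall>y \<in> verts H. adj H x y \<longleftrightarrow> adj J (g x) (g y)"
    using assms(2) by (auto simp: graph_iso_def)
  have "\<forall>x \<in> verts G. \<forall>y \<in> verts G. adj G x y \<longleftrightarrow> adj J ((g \<circ> f) x) ((g \<circ> f) y)"
    using f g bij_betwE[OF f(1)] by simp
  then show ?thesis
    unfolding graph_iso_def using bij_betw_trans[OF f(1) g(1)] by blast
qed

lemma iso_class_eq:
  assumes "graph_iso G H"
  shows "iso_class G = iso_class H"
proof -
  have "graph_iso G J \<longleftrightarrow> graph_iso H J" for J :: "'a graph"
    using graph_iso_trans[OF assms, of J] graph_iso_trans[OF graph_iso_sym[OF assms], of J] by blast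
  then show ?thesis
    by (simp add: iso_class_def)
qed

section \<open>Hamilton cycles and paths as vertex lists\<close>

definition ham_path :: "'a graph \<Rightarrow> 'a list \<Rightarrow> bool" where
  "ham_path G xs \<longleftrightarrow> distinct xs \<and> set xs = verts G \<and> successively (adj G) xs"

text \<open>Two adjacent vertices already satisfy this predicate; lemmas that cut a cycle open
  therefore assume at least three vertices.\<close>

definition ham_cycle :: "'a graph \<Rightarrow> 'a list \<Rightarrow> bool" where
  "ham_cycle G xs \<longleftrightarrow> ham_path G xs \<and> adj G (last xs) (hd xs)"

definition hamiltonian :: "'a graph \<Rightarrow> bool" where
  "hamiltonian G \<longleftrightarrow> (\<exists>xs. ham_cycle G xs)"

lemma ham_cycle_rotate:
  assumes "hamiltonian G" "x \<in> verts G"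
  obtains ys where "ham_cycle G (x # ys)"
proof -
  obtain xs where xs: "ham_cycle G xs"
    using assms by (auto simp: hamiltonian_def)
  then obtain as bs where "xs = as @ x # bs"
    using assms(2) split_list[of x xs] by (auto simp: ham_cycle_def ham_path_def)
  then have "ham_cycle G (x # bs @ as)"
    using xs by (cases "as = []"; cases "bs = []")
      (auto simp: ham_cycle_def ham_path_def successively_append_iff successively_Cons)
  then show ?thesis
    using that by blast
qed

lemma length_ham_path: "ham_path G xs \<Longrightarrow> length xs = card (verts G)"
  by (metis distinct_card ham_path_def)

lemma ham_cycle_nth:
  assumes xs: "ham_cycle G xs" and i: "i < length xs"
  shows "adj G (xs ! i) (xs ! (Suc i mod length xs))"
proof (cases "Suc i = length xs")
  case True
  moreover have "xs \<noteq> []" "i = length xs - 1"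
    using i True by auto
  ultimately show ?thesis
    using xs by (simp add: ham_cycle_def last_conv_nth hd_conv_nth)
next
  case False
  then show ?thesis
    using xs i by (simp add: ham_cycle_def ham_path_def successively_conv_nth)
qed

lemma successively_adj_rev: "successively (adj G) (rev xs) \<longleftrightarrow> successively (adj G) xs"
  by (simp add: insert_commute)

lemma successively_clique:
  assumes "distinct xs" "\<And>a b. a \<in> set xs \<Longrightarrow> b \<in> set xs \<Longrightarrow> a \<noteq> b \<Longrightarrow> R a b"
  shows "successively R xs"
  using assms
proof (induction xs)
  case (Cons a xs)
  then have "xs \<noteq> [] \<Longrightarrow> R a (hd xs)"
    by (metis distinct.simps(2) hd_in_set list.set_intros)
  moreover have "successively R xs"
    using Cons by simp
  ultimately show ?case
    by (auto simp: successively_Cons)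
qed simp

text \<open>Makes a copy of a cycle or path on \<open>n\<close> vertices spanning when the host
  graph also has \<open>n\<close> vertices.\<close>

lemma copy_bij:
  assumes "finite V" "card V = n" "inj_on f {..<n}" "f ` {..<n} \<subseteq> V"
  shows "f ` {..<n} = V"
  using assms by (simp add: card_image card_subset_eq)

lemma contains_path_graph_iff:
  assumes "simple_graph G" "card (verts G) = n"
  shows "contains_copy G (path_graph n) \<longleftrightarrow> (\<exists>xs. ham_path G xs)"
proof
  assume "contains_copy G (path_graph n)"
  then obtain f where f: "inj_on f {..<n}" "f ` {..<n} \<subseteq> verts G"
    and e: "\<And>e. e \<in> {{i, i + 1} |i. i + 1 < n} \<Longrightarrow> f ` e \<in> edges G"
    by (auto simp: contains_copy_def path_graph_def)
  have f3: "adj G (f i) (f (Suc i))" if "Suc i < n" for i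
    using e[of "{i, i + 1}"] that by auto
  have "f ` {..<n} = verts G"
    using copy_bij[OF _ assms(2) f(1,2)] assms(1) by (simp add: simple_graph_def)
  then have "ham_path G (map f [0..<n])"
    using f f3 by (auto simp: ham_path_def distinct_map atLeast0LessThan successively_conv_nth)
  then show "\<exists>xs. ham_path G xs" by blast
next
  assume "\<exists>xs. ham_path G xs"
  then obtain xs where xs: "ham_path G xs" by blast
  then have n: "length xs = n"
    using assms length_ham_path by blast
  have "inj_on ((!) xs) {..<n}"
    by (rule inj_on_nth) (use xs n in \<open>simp_all add: ham_cycle_def ham_path_def\<close>)
  moreover have "(!) xs ` {..<n} \<subseteq> verts G"
  proof
    fix v assume "v \<in> (!) xs ` {..<n}"
    then show "v \<in> verts G"
      using xs n nth_mem[of _ xs] by (auto simp: ham_cycle_def ham_path_def)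
  qed
  moreover have "adj G (xs ! i) (xs ! Suc i)" if "Suc i < n" for i
    using xs n that by (simp add: ham_path_def successively_conv_nth)
  ultimately show "contains_copy G (path_graph n)"
    unfolding contains_copy_def path_graph_def by (intro exI[of _ "\<lambda>i. xs ! i"]) auto
qed

lemma contains_cycle_graph_iff:
  assumes "simple_graph G" "card (verts G) = n" "n > 0"
  shows "contains_copy G (cycle_graph n) \<longleftrightarrow> hamiltonian G"
proof
  assume "contains_copy G (cycle_graph n)"
  then obtain f where f: "inj_on f {..<n}" "f ` {..<n} \<subseteq> verts G"
    and e: "\<And>e. e \<in> {{i, (i + 1) mod n} |i. i < n} \<Longrightarrow> f ` e \<in> edges G"
    by (auto simp: contains_copy_def cycle_graph_def)
  have f3: "adj G (f i) (f ((i + 1) mod n))" if "i < n" for i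
    using e[of "{i, (i + 1) mod n}"] that by auto
  have im: "f ` {..<n} = verts G"
    using copy_bij[OF _ assms(2) f(1,2)] assms(1) by (simp add: simple_graph_def)
  have "adj G (f i) (f (Suc i))" if "Suc i < n" for i
    using f3[of i] that by simp
  moreover have "adj G (f (n - 1)) (f 0)"
    using f3[of "n - 1"] assms by simp
  ultimately have "ham_cycle G (map f [0..<n])"
    using f f3 im assms(3)
    by (auto simp: ham_cycle_def ham_path_def distinct_map atLeast0LessThan successively_conv_nth
        last_map hd_map)
  then show "hamiltonian G"
    by (auto simp: hamiltonian_def)
next
  assume "hamiltonian G"
  then obtain xs where xs: "ham_cycle G xs"
    by (auto simp: hamiltonian_def)
  then have n: "length xs = n"
    using assms length_ham_path by (auto simp: ham_cycle_def)
  have "inj_on ((!) xs) {..<n}"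
    by (rule inj_on_nth) (use xs n in \<open>simp_all add: ham_cycle_def ham_path_def\<close>)
  moreover have "(!) xs ` {..<n} \<subseteq> verts G"
  proof
    fix v assume "v \<in> (!) xs ` {..<n}"
    then show "v \<in> verts G"
      using xs n nth_mem[of _ xs] by (auto simp: ham_cycle_def ham_path_def)
  qed
  moreover have "adj G (xs ! i) (xs ! (Suc i mod n))" if "i < n" for i
    using ham_cycle_nth[OF xs] n that by blast
  ultimately show "contains_copy G (cycle_graph n)"
    unfolding contains_copy_def cycle_graph_def by (intro exI[of _ "\<lambda>i. xs ! i"]) auto
qed

section \<open>The Kelmans operation\<close>

lemma verts_kelmans [simp]: "verts (kelmans G x y) = verts G"
  by (simp add: kelmans_def Let_def)

lemma simple_graph_kelmans:
  assumes G: "simple_graph G" and "y \<in> verts G"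
  shows "simple_graph (kelmans G x y)"
proof (rule simple_graphI)
  show "finite (verts (kelmans G x y))"
    using G by (simp add: simple_graph_def)
next
  fix e assume "e \<in> edges (kelmans G x y)"
  then consider "e \<in> edges G" | w where "e = {y, w}" "w \<in> neighbors G x" "w \<noteq> y"
    by (auto simp: kelmans_def Let_def)
  then show "\<exists>u v. e = {u, v} \<and> u \<in> verts (kelmans G x y) \<and> v \<in> verts (kelmans G x y) \<and> u \<noteq> v"
  proof cases
    case 1
    then show ?thesis using edge_pair[OF G] by (metis verts_kelmans)
  next
    case 2
    then show ?thesis using adjD[OF G, of x w] assms by (auto simp: neighbors_def)
  qed
qed

text \<open>Away from \<open>x\<close> and \<open>y\<close> themselves, the operation replaces the
  two neighbourhoods by their intersection at \<open>x\<close> and their union at \<open>y\<close>.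
  Most later arguments use this symmetric picture instead of the set of moved neighbours.\<close>

lemma adj_kelmans:
  assumes G: "simple_graph G" and "x \<noteq> y"
  shows "u \<notin> {x, y} \<Longrightarrow> v \<notin> {x, y} \<Longrightarrow> adj (kelmans G x y) u v \<longleftrightarrow> adj G u v"
    and "adj (kelmans G x y) x y \<longleftrightarrow> adj G x y"
    and "v \<notin> {x, y} \<Longrightarrow> adj (kelmans G x y) x v \<longleftrightarrow> adj G x v \<and> adj G y v"
    and "v \<notin> {x, y} \<Longrightarrow> adj (kelmans G x y) y v \<longleftrightarrow> adj G x v \<or> adj G y v"
  using assms(2) adjD(3)[OF G, of x x]
  by (auto simp: kelmans_def Let_def neighbors_def doubleton_eq_iff)

text \<open>Let the cycle of the new graph run y, p, x, q. The two cycle neighbours of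
  \<open>x\<close> are common neighbours of \<open>x\<close> and \<open>y\<close> in
  \<open>G\<close>, so either vertex may use them; each cycle neighbour of \<open>y\<close> belongs
  to at least one of \<open>x\<close> and \<open>y\<close>. Exchanging \<open>x\<close> and
  \<open>y\<close> or reversing a segment then yields a cycle of \<open>G\<close>.\<close>

lemma hamiltonian_kelmans:
  assumes G: "simple_graph G" and n: "card (verts G) \<ge> 3"
    and xy: "x \<in> verts G" "y \<in> verts G" "x \<noteq> y"
    and ham: "hamiltonian (kelmans G x y)"
  shows "hamiltonian G"
proof -
  let ?K = "kelmans G x y"
  obtain ys where ys: "ham_cycle ?K (y # ys)"
    using ham_cycle_rotate[OF ham] xy by auto
  then have "x \<in> set ys"
    using xy by (auto simp: ham_cycle_def ham_path_def)
  then obtain p q where pq: "ys = p @ x # q"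
    by (meson split_list)
  have dist: "distinct (y # p @ x # q)" and V: "set (y # p @ x # q) = verts G"
    and suc: "successively (adj ?K) (y # p @ x # q)"
    and last: "adj ?K (last (y # p @ x # q)) y"
    using ys pq by (auto simp: ham_cycle_def ham_path_def)
  have len: "p \<noteq> [] \<or> q \<noteq> []"
    using n dist V distinct_card[OF dist] by auto
  have in_pq: "successively (adj G) r" if "r = p \<or> r = q" for r
  proof -
    have "successively (adj ?K) r"
      using that suc by (auto simp: successively_append_iff successively_Cons)
    then show ?thesis
    proof (rule successively_mono)
      fix a b assume "a \<in> set r" "b \<in> set r" "adj ?K a b"
      then show "adj G a b"
        using adj_kelmans(1)[OF G xy(3), of a b] dist that by auto
    qed
  qed
  have ends: "hd r \<in> set r" "last r \<in> set r" "hd r \<notin> {x, y}" "last r \<notin> {x, y}"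
    if "r = p \<or> r = q" "r \<noteq> []" for r
    using that dist hd_in_set[of r] last_in_set[of r] by auto
  have s: "successively (adj G) p" "successively (adj G) q"
    "successively (adj G) (rev p)" "successively (adj G) (rev q)"
    using in_pq by (simp_all add: successively_adj_rev del: successively_rev)
  have cycle: "hamiltonian G" if "distinct xs" "set xs = verts G" "successively (adj G) xs"
    "adj G (last xs) (hd xs)" for xs
    using that by (auto simp: hamiltonian_def ham_cycle_def ham_path_def)
  have kx: "adj G x v" "adj G y v" if "adj ?K x v \<or> adj ?K v x" "v \<notin> {x, y}" for v
    using that adj_kelmans(3)[OF G xy(3) that(2)] adj_sym[of v x ?K] by auto
  have ky: "adj G x v \<or> adj G y v" if "adj ?K y v \<or> adj ?K v y" "v \<notin> {x, y}" for v
    using that adj_kelmans(4)[OF G xy(3) that(2)] adj_sym[of v y ?K] by auto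
  have kxy: "adj G y x" if "adj ?K y x \<or> adj ?K x y"
    using that adj_kelmans(2)[OF G xy(3)] adj_sym[of y x ?K] adj_sym[of y x G] by auto
  note simps = successively_append_iff successively_Cons hd_rev last_rev insert_commute
    hd_append last_append
  consider "p = []" "q \<noteq> []" | "q = []" "p \<noteq> []" | "p \<noteq> []" "q \<noteq> []"
    using len by blast
  then show ?thesis
  proof cases
    case 1
    have "adj ?K y x" "adj ?K x (hd q)" "adj ?K (last q) y"
      using suc last 1 by (simp_all add: successively_Cons)
    then have e: "adj G y x" "adj G x (hd q)" "adj G y (hd q)"
      "adj G x (last q) \<or> adj G y (last q)"
      using kx ky kxy ends[of q] 1 by blast+
    then consider "adj G x (last q)" | "adj G y (last q)" by blast
    then show ?thesis
    proof cases
      case a: 1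
      show ?thesis
        by (rule cycle[of "y # q @ [x]"]) (use 1 a e s dist V in \<open>auto simp: simps\<close>)
    next
      case a: 2
      show ?thesis
        by (rule cycle[of "y # x # q"]) (use 1 a e s dist V in \<open>auto simp: simps\<close>)
    qed
  next
    case 2
    have "adj ?K x y" "adj ?K (last p) x" "adj ?K y (hd p)"
      using suc last 2 by (simp_all add: successively_append_iff successively_Cons)
    then have e: "adj G y x" "adj G x (last p)" "adj G y (last p)"
      "adj G x (hd p) \<or> adj G y (hd p)"
      using kx ky kxy ends[of p] 2 by blast+
    then consider "adj G x (hd p)" | "adj G y (hd p)" by blast
    then show ?thesis
    proof cases
      case a: 1
      show ?thesis
        by (rule cycle[of "x # p @ [y]"]) (use 2 a e s dist V in \<open>auto simp: simps\<close>)
    next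
      case a: 2
      show ?thesis
        by (rule cycle[of "y # p @ [x]"]) (use 2 a e s dist V in \<open>auto simp: simps\<close>)
    qed
  next
    case 3
    have "adj ?K y (hd p)" "adj ?K (last p) x" "adj ?K x (hd q)" "adj ?K (last q) y"
      using suc last 3 by (simp_all add: successively_append_iff successively_Cons)
    then have e: "adj G x (last p)" "adj G y (last p)" "adj G x (hd q)" "adj G y (hd q)"
      "adj G x (hd p) \<or> adj G y (hd p)" "adj G x (last q) \<or> adj G y (last q)"
      using kx ky ends[of p] ends[of q] 3 by blast+
    then consider "adj G y (hd p)" "adj G y (last q)" | "adj G x (hd p)" "adj G x (last q)"
      | "adj G x (hd p)" "adj G y (last q)" | "adj G y (hd p)" "adj G x (last q)" by blast
    then show ?thesis
    proof cases
      case a: 1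
      show ?thesis
        by (rule cycle[of "y # p @ x # q"]) (use 3 a e s dist V in \<open>auto simp: simps\<close>)
    next
      case a: 2
      show ?thesis
        by (rule cycle[of "x # p @ y # q"]) (use 3 a e s dist V in \<open>auto simp: simps\<close>)
    next
      case a: 3
      show ?thesis
        by (rule cycle[of "x # p @ y # rev q"]) (use 3 a e s dist V in \<open>auto simp: simps\<close>)
    next
      case a: 4
      show ?thesis
        by (rule cycle[of "y # p @ x # rev q"]) (use 3 a e s dist V in \<open>auto simp: simps\<close>)
    qed
  qed
qed

section \<open>Degrees in non-Hamiltonian graphs\<close>

lemma degree_mono:
  assumes "simple_graph H" "edges G \<subseteq> edges H"
  shows "degree G v \<le> degree H v"
  unfolding degree_def
  by (rule card_mono) (use assms finite_neighbors in \<open>auto simp: neighbors_def\<close>)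

text \<open>The crossing-chord argument behind Ore's theorem. The neighbours of the first vertex,
  shifted one position back, and those of the last vertex occupy positions among the first n - 1. A
  shared position \<open>i\<close> would give a Hamilton cycle: run to \<open>p ! i\<close>, jump to
  the last vertex, return backwards to \<open>p ! Suc i\<close> and close at the first
  vertex.\<close>

lemma ham_path_ends_degree:
  assumes G: "simple_graph G" and n: "card (verts G) \<ge> 1"
    and p: "ham_path G p" and nh: "\<not> hamiltonian G"
  shows "degree G (hd p) + degree G (last p) < card (verts G)"
proof -
  let ?n = "card (verts G)"
  let ?I = "{i. i < ?n - 1 \<and> adj G (hd p) (p ! Suc i)}"
  let ?J = "{i. i < ?n - 1 \<and> adj G (last p) (p ! i)}"
  have len: "length p = ?n"
    using p by (rule length_ham_path)
  then have ne: "p \<noteq> []"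
    using n by auto
  have V: "set p = verts G" "distinct p" "successively (adj G) p"
    using p by (auto simp: ham_path_def)
  have "neighbors G (hd p) \<subseteq> (\<lambda>i. p ! Suc i) ` ?I"
  proof
    fix b assume "b \<in> neighbors G (hd p)"
    then have b: "adj G (hd p) b" by (simp add: neighbors_def)
    then have "b \<in> set p" "b \<noteq> p ! 0"
      using adjD[OF G b] V ne by (auto simp: hd_conv_nth)
    then obtain j where "j < ?n" "b = p ! j" "j \<noteq> 0"
      using len by (metis in_set_conv_nth)
    then show "b \<in> (\<lambda>i. p ! Suc i) ` ?I"
      using b by (intro image_eqI[of _ _ "j - 1"]) auto
  qed
  then have u: "degree G (hd p) \<le> card ?I"
    unfolding degree_def by (intro surj_card_le) simp_all
  have "neighbors G (last p) \<subseteq> (\<lambda>i. p ! i) ` ?J"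
  proof
    fix b assume "b \<in> neighbors G (last p)"
    then have b: "adj G (last p) b" by (simp add: neighbors_def)
    then have "b \<in> set p" "b \<noteq> p ! (?n - 1)"
      using adjD[OF G b] V ne len by (auto simp: last_conv_nth)
    then obtain j where "j < ?n" "b = p ! j" "j \<noteq> ?n - 1"
      using len by (metis in_set_conv_nth)
    then show "b \<in> (\<lambda>i. p ! i) ` ?J"
      using b by (intro image_eqI[of _ _ j]) auto
  qed
  then have v: "degree G (last p) \<le> card ?J"
    unfolding degree_def by (intro surj_card_le) simp_all
  have "?I \<inter> ?J = {}"
  proof (rule ccontr)
    assume "?I \<inter> ?J \<noteq> {}"
    then obtain i where i: "i < ?n - 1" "adj G (hd p) (p ! Suc i)" "adj G (last p) (p ! i)"
      by blast
    let ?a = "take (Suc i) p" and ?b = "drop (Suc i) p"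
    have i': "Suc i < length p"
      using i len by simp
    have ends: "?a \<noteq> []" "?b \<noteq> []" "hd ?a = hd p" "last ?a = p ! i" "hd ?b = p ! Suc i"
      "last ?b = last p"
      using i' ne by (auto simp: hd_conv_nth hd_drop_conv_nth take_Suc_conv_app_nth hd_append hd_take)
    have pp: "p = ?a @ ?b" by simp
    have ab: "distinct (?a @ ?b)" "set (?a @ ?b) = verts G"
      "successively (adj G) (?a @ ?b)"
      using V by simp_all
    then have s: "successively (adj G) ?a" "successively (adj G) (rev ?b)"
      unfolding successively_adj_rev by (simp_all only: successively_append_iff)
    have "ham_cycle G (?a @ rev ?b)"
      unfolding ham_cycle_def ham_path_def
    proof (intro conjI)
      show "distinct (?a @ rev ?b)" "set (?a @ rev ?b) = verts G"
        using ab(1,2) by (simp_all del: append_take_drop_id)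
      show "successively (adj G) (?a @ rev ?b)"
        unfolding successively_append_iff using s ends i(3) adj_sym[of "last p" "p ! i" G]
        by (simp add: hd_rev)
      show "adj G (last (?a @ rev ?b)) (hd (?a @ rev ?b))"
        using ends i(2) adj_sym[of "hd p" "p ! Suc i" G] by (simp add: last_rev)
    qed
    then show False
      using nh by (auto simp: hamiltonian_def)
  qed
  then have "card ?I + card ?J = card (?I \<union> ?J)"
    by (intro card_Un_disjoint[symmetric]) auto
  also have "\<dots> \<le> card {..<?n - 1}"
    by (rule card_mono) auto
  finally show ?thesis
    using u v n by simp
qed

lemma simple_graph_add_edge:
  assumes "simple_graph G" "u \<in> verts G" "v \<in> verts G" "u \<noteq> v"
  shows "simple_graph (add_edges G {{u, v}})"
  using assms by (auto simp: simple_graph_def add_edges_def nsets_def)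

text \<open>A Hamilton cycle that appears only with the new edge must traverse it. Seen from
  \<open>u\<close>, the vertex \<open>v\<close> is then the next or the last one on the cycle, and
  deleting the edge opens the cycle to a path between them.\<close>

lemma ham_path_of_add_edge:
  assumes G: "simple_graph G" and n: "card (verts G) \<ge> 3"
    and uv: "u \<in> verts G" "v \<in> verts G" "u \<noteq> v"
    and nh: "\<not> hamiltonian G" and ham: "hamiltonian (add_edges G {{u, v}})"
  obtains p where "ham_path G p" "{hd p, last p} = {u, v}"
proof -
  let ?K = "add_edges G {{u, v}}"
  obtain ys where ys: "ham_cycle ?K (u # ys)"
    using ham_cycle_rotate[OF ham] uv by (auto simp: add_edges_def)
  then have "v \<in> set ys"
    using uv by (auto simp: ham_cycle_def ham_path_def add_edges_def)
  then obtain p q where pq: "ys = p @ v # q"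
    by (meson split_list)
  have dist: "distinct (u # p @ v # q)" and V: "set (u # p @ v # q) = verts G"
    and suc: "successively (adj ?K) (u # p @ v # q)"
    and last: "adj ?K (last (u # p @ v # q)) u"
    using ys pq by (auto simp: ham_cycle_def ham_path_def add_edges_def)
  have K: "adj G a b" if "adj ?K a b" "{a, b} \<noteq> {u, v}" for a b
    using that by (auto simp: add_edges_def)
  have u: "successively (adj G) (p @ v # q)"
  proof (rule successively_mono)
    show "successively (adj ?K) (p @ v # q)"
      using suc by (simp add: successively_Cons)
    show "adj G a b" if "a \<in> set (p @ v # q)" "b \<in> set (p @ v # q)" "adj ?K a b" for a b
      using K[OF that(3)] that(1,2) dist by (auto simp: doubleton_eq_iff)
  qed
  consider "p = []" "q = []" | "p = []" "q \<noteq> []" | "q = []" "p \<noteq> []" | "p \<noteq> []" "q \<noteq> []"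
    by blast
  then show ?thesis
  proof cases
    case 1
    then show ?thesis using n V[symmetric] uv(3) by simp
  next
    case 2
    have "last q \<noteq> v"
      using 2 dist last_in_set[of q] by auto
    moreover have "adj ?K (last q) u"
      using last 2 by simp
    ultimately have "adj G (last q) u"
      using K[of "last q" u] uv by (auto simp: doubleton_eq_iff)
    then have "ham_path G (v # q @ [u])"
      using 2 u dist V by (auto simp: ham_path_def successively_append_iff successively_Cons)
    then show ?thesis
      by (rule that) auto
  next
    case 3
    have "hd p \<noteq> v"
      using 3 dist hd_in_set[of p] by auto
    moreover have "adj ?K u (hd p)"
      using suc 3 by (simp add: successively_append_iff successively_Cons)
    ultimately have "adj G u (hd p)"
      using K[of u "hd p"] uv by (auto simp: doubleton_eq_iff)
    then have "ham_path G (u # p @ [v])"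
      using 3 u dist V by (auto simp: ham_path_def successively_append_iff successively_Cons)
    then show ?thesis
      by (rule that) auto
  next
    case 4
    have "hd p \<noteq> v" "last q \<noteq> v"
      using 4 dist hd_in_set[of p] last_in_set[of q] by auto
    moreover have "adj ?K u (hd p)" "adj ?K (last q) u"
      using suc last 4 by (simp_all add: successively_append_iff successively_Cons)
    ultimately have "adj G u (hd p)" "adj G (last q) u"
      using K[of u "hd p"] K[of "last q" u] uv by (auto simp: doubleton_eq_iff)
    then have "ham_cycle G (u # p @ v # q)"
      using 4 u dist V
      by (auto simp: ham_cycle_def ham_path_def successively_append_iff successively_Cons)
    then show ?thesis
      using nh by (auto simp: hamiltonian_def)
  qed
qed

lemma ex_maximal_nonhamiltonian:
  assumes G: "simple_graph G" and nh: "\<not> hamiltonian G"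
  obtains M where "simple_graph M" "verts M = verts G" "edges G \<subseteq> edges M" "\<not> hamiltonian M"
    "\<And>u v. u \<in> verts G \<Longrightarrow> v \<in> verts G \<Longrightarrow> u \<noteq> v \<Longrightarrow> \<not> adj M u v \<Longrightarrow>
      hamiltonian (add_edges M {{u, v}})"
proof -
  let ?P = "\<lambda>M. simple_graph M \<and> verts M = verts G \<and> edges G \<subseteq> edges M \<and> \<not> hamiltonian M"
  have fin: "finite (Pow (verts G))"
    using G by (simp add: simple_graph_def)
  have sub: "edges M \<subseteq> Pow (verts G)" if "?P M" for M
    using that by (auto simp: simple_graph_def nsets_def)
  have "\<forall>M. ?P M \<longrightarrow> card (edges M) < Suc (card (Pow (verts G)))"
    using card_mono[OF fin sub] by (auto simp: less_Suc_eq_le)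
  moreover have "?P G"
    using assms by simp
  ultimately obtain M where M: "?P M" and max: "\<forall>M'. ?P M' \<longrightarrow> card (edges M') \<le> card (edges M)"
    using ex_has_greatest_nat[of ?P G "\<lambda>M. card (edges M)"] by blast
  show ?thesis
  proof (rule that)
    fix u v assume uv: "u \<in> verts G" "v \<in> verts G" "u \<noteq> v" "\<not> adj M u v"
    show "hamiltonian (add_edges M {{u, v}})"
    proof (rule ccontr)
      assume nh': "\<not> hamiltonian (add_edges M {{u, v}})"
      have "?P (add_edges M {{u, v}})"
        using M uv nh' simple_graph_add_edge[of M u v] by (auto simp: add_edges_def)
      then have "card (edges (add_edges M {{u, v}})) \<le> card (edges M)"
        using max by blast
      moreover have "finite (edges M)"
        using finite_subset[OF sub[OF M] fin] .
      ultimately show False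
        using uv by (simp add: add_edges_def)
    qed
  qed (use M in auto)
qed

text \<open>The weak half of Chvatal's degree condition. As in the proof of his theorem, take a nonadjacent
  pair with maximal degree sum in an edge-maximal non-Hamiltonian supergraph; \<open>h\<close> is the smaller
  degree of the two.\<close>

lemma nonhamiltonian_small_degrees:
  assumes G: "simple_graph G" and n: "card (verts G) = n" "n \<ge> 3" and nh: "\<not> hamiltonian G"
    and k: "\<And>v. v \<in> verts G \<Longrightarrow> k \<le> degree G v"
  obtains h A where "k \<le> h" "2 * h + 1 \<le> n" "A \<subseteq> verts G" "card A = h"
    "\<And>a. a \<in> A \<Longrightarrow> degree G a \<le> h"
proof -
  obtain M where M: "simple_graph M" "verts M = verts G" "edges G \<subseteq> edges M" "\<not> hamiltonian M"
    and ham: "\<And>u v. u \<in> verts G \<Longrightarrow> v \<in> verts G \<Longrightarrow> u \<noteq> v \<Longrightarrow> \<not> adj M u v \<Longrightarrow>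
      hamiltonian (add_edges M {{u, v}})"
    using ex_maximal_nonhamiltonian[OF G nh] by metis
  have fin: "finite (verts G)"
    using G by (simp add: simple_graph_def)
  let ?Q = "\<lambda>(u, v). u \<in> verts G \<and> v \<in> verts G \<and> u \<noteq> v \<and> \<not> adj M u v"
  let ?d = "\<lambda>(u, v). degree M u + degree M v"
  \<comment> \<open>Otherwise \<open>M\<close> is complete, and any enumeration of its at least
    three vertices is a Hamilton cycle.\<close>
  have "\<exists>e. ?Q e"
  proof (rule ccontr)
    assume "\<not> (\<exists>e. ?Q e)"
    then have clique: "adj M u v" if "u \<in> verts G" "v \<in> verts G" "u \<noteq> v" for u v
      using that by auto
    obtain xs where xs: "set xs = verts G" "distinct xs"
      using finite_distinct_list[OF fin] by blast
    then have len: "length xs = n"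
      using n distinct_card by metis
    have "successively (adj M) xs"
      by (rule successively_clique) (use xs clique in auto)
    moreover have "last xs \<noteq> hd xs"
    proof -
      have "xs \<noteq> []" "length xs - 1 \<noteq> 0" "length xs - 1 < length xs"
        using len n by auto
      then show ?thesis
        using xs(2) nth_eq_iff_index_eq[OF xs(2), of "length xs - 1" 0]
        by (simp add: last_conv_nth hd_conv_nth)
    qed
    then have "adj M (last xs) (hd xs)"
      using clique xs len n last_in_set[of xs] hd_in_set[of xs] by fastforce
    ultimately show False
      using M xs by (auto simp: hamiltonian_def ham_cycle_def ham_path_def)
  qed
  then obtain e0 where e0: "?Q e0" by blast
  have "\<forall>e. ?Q e \<longrightarrow> ?d e < Suc (2 * n)"
    using degree_le_card[OF M(1)] M(2) n by (auto simp: less_Suc_eq_le mult_2 intro: add_mono)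
  then obtain e where "?Q e" "\<forall>e'. ?Q e' \<longrightarrow> ?d e' \<le> ?d e"
    using ex_has_greatest_nat[of ?Q e0 ?d] e0 by blast
  then have "\<exists>u v. ?Q (u, v) \<and> (\<forall>e'. ?Q e' \<longrightarrow> ?d e' \<le> ?d (u, v)) \<and> degree M u \<le> degree M v"
  proof (cases e)
    case (Pair u v)
    show ?thesis
    proof (cases "degree M u \<le> degree M v")
      case True
      then show ?thesis
        using \<open>?Q e\<close> \<open>\<forall>e'. ?Q e' \<longrightarrow> ?d e' \<le> ?d e\<close> Pair by blast
    next
      case False
      have "?Q (v, u)" "?d (v, u) = ?d (u, v)" "degree M v \<le> degree M u"
        using \<open>?Q e\<close> Pair False by (auto simp: insert_commute)
      moreover have "\<forall>e'. ?Q e' \<longrightarrow> ?d e' \<le> ?d (v, u)"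
        using \<open>\<forall>e'. ?Q e' \<longrightarrow> ?d e' \<le> ?d e\<close> \<open>?d (v, u) = ?d (u, v)\<close> Pair
        by (simp add: add.commute)
      ultimately show ?thesis by blast
    qed
  qed
  then obtain u v where uv: "u \<in> verts G" "v \<in> verts G" "u \<noteq> v" "\<not> adj M u v"
    and max: "\<And>a b. ?Q (a, b) \<Longrightarrow> degree M a + degree M b \<le> degree M u + degree M v"
    and le: "degree M u \<le> degree M v"
    by auto
  have card_M: "3 \<le> card (verts M)" "card (verts M) = n"
    using n M by auto
  obtain p where p: "ham_path M p" "{hd p, last p} = {u, v}"
    by (rule ham_path_of_add_edge[OF M(1) card_M(1) _ _ uv(3) M(4) ham[OF uv]])
      (use uv M in auto)
  have sum: "degree M u + degree M v < n"
    using ham_path_ends_degree[OF M(1) _ p(1) M(4)] p(2) card_M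
    by (auto simp: doubleton_eq_iff)
  \<comment> \<open>The non-neighbours of \<open>v\<close> other than \<open>v\<close> number n - 1
    - deg v, hence at least deg u by the degree-sum bound. Maximality of the pair, applied to (a,
    v), bounds the degree of each such \<open>a\<close> by deg u.\<close>
  let ?B = "verts G - insert v (neighbors M v)"
  have "neighbors M v \<subseteq> verts G" "v \<notin> neighbors M v"
    using adjD(2)[OF M(1), of v] adjD(3)[OF M(1), of v v] M(2) by (auto simp: neighbors_def)
  then have "card ?B = n - Suc (degree M v)"
    using uv n fin finite_neighbors[OF M(1)]
    by (subst card_Diff_subset) (auto simp: degree_def)
  then have "degree M u \<le> card ?B"
    using sum by linarith
  then obtain A where A: "A \<subseteq> ?B" "card A = degree M u"
    by (meson obtain_subset_with_card_n)
  show ?thesis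
  proof (rule that)
    show "k \<le> degree M u"
      using k[OF uv(1)] degree_mono[OF M(1,3), of u] by simp
    show "2 * degree M u + 1 \<le> n"
      using le sum by simp
    show "A \<subseteq> verts G" "card A = degree M u"
      using A by auto
    show "degree G a \<le> degree M u" if "a \<in> A" for a
    proof -
      have "a \<in> verts G" "a \<noteq> v" "\<not> adj M a v"
        using that A adj_sym[of a v M] by (auto simp: neighbors_def)
      then have "degree M a \<le> degree M u"
        using max[of a v] uv(2) by simp
      then show ?thesis
        using degree_mono[OF M(1,3), of a] by simp
    qed
  qed
qed

section \<open>The extremal structure\<close>

text \<open>This is the join of a clique on \<open>S\<close> with the disjoint union of the edgeless
  graph on \<open>A\<close> and a clique on the remaining vertices. It is described inside a given
  vertex set because Kelmans operations keep that set, whereas the concrete families live on encoded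
  numbers.\<close>

definition split_form :: "'a graph \<Rightarrow> 'a set \<Rightarrow> 'a set \<Rightarrow> bool" where
  "split_form G S A \<longleftrightarrow> simple_graph G \<and> S \<subseteq> verts G \<and> A \<subseteq> verts G \<and> S \<inter> A = {} \<and>
     (\<forall>u \<in> verts G. \<forall>v \<in> verts G.
        adj G u v \<longleftrightarrow> u \<noteq> v \<and> (u \<in> S \<or> v \<in> S \<or> (u \<notin> A \<and> v \<notin> A)))"

lemma split_formD:
  assumes "split_form G S A"
  shows "simple_graph G" "S \<subseteq> verts G" "A \<subseteq> verts G" "S \<inter> A = {}" "finite (verts G)"
    "finite S" "finite A"
    and "\<And>u v. u \<in> verts G \<Longrightarrow> v \<in> verts G \<Longrightarrow>
      adj G u v \<longleftrightarrow> u \<noteq> v \<and> (u \<in> S \<or> v \<in> S \<or> (u \<notin> A \<and> v \<notin> A))"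
  using assms by (auto simp: split_form_def simple_graph_def intro: finite_subset)

text \<open>Adjacency depends only on the parts containing the two vertices, so bijections between
  corresponding parts glue to an isomorphism.\<close>

lemma split_form_iso:
  assumes G: "split_form G S A" and H: "split_form H T B"
    and card: "card S = card T" "card A = card B" "card (verts G) = card (verts H)"
  shows "graph_iso G H"
proof -
  note G' = split_formD[OF G] and H' = split_formD[OF H]
  let ?K = "verts G - S - A" and ?L = "verts H - T - B"
  have "?K = verts G - (S \<union> A)" "?L = verts H - (T \<union> B)"
    by auto
  then have "card ?K = card ?L"
    using G'(2-7) H'(2-7) card by (simp add: card_Diff_subset card_Un_disjoint)
  then obtain f g h where f: "bij_betw f S T" and g: "bij_betw g A B" and h: "bij_betw h ?K ?L"
    using finite_same_card_bij[of S T] finite_same_card_bij[of A B] finite_same_card_bij[of ?K ?L]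
      G' H' card by auto
  define F where "F v = (if v \<in> S then f v else if v \<in> A then g v else h v)" for v
  have FS: "bij_betw F S T"
    using f by (subst bij_betw_cong[of S F f]) (auto simp: F_def)
  have FA: "bij_betw F A B"
    using g G'(4) by (subst bij_betw_cong[of A F g]) (auto simp: F_def)
  have FK: "bij_betw F ?K ?L"
    using h by (subst bij_betw_cong[of ?K F h]) (auto simp: F_def)
  have "bij_betw F (S \<union> A \<union> ?K) (T \<union> B \<union> ?L)"
    using H'(4) by (intro bij_betw_combine FS FA FK) auto
  moreover have "S \<union> A \<union> ?K = verts G" "T \<union> B \<union> ?L = verts H"
    using G' H' by auto
  ultimately have F: "bij_betw F (verts G) (verts H)"
    by simp
  have ST: "F v \<in> T \<longleftrightarrow> v \<in> S" and AB: "F v \<in> B \<longleftrightarrow> v \<in> A" if "v \<in> verts G" for v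
    using that bij_betwE[OF FS] bij_betwE[OF FA] bij_betwE[OF FK] H'(4) by blast+
  have "adj G u v \<longleftrightarrow> adj H (F u) (F v)" if uv: "u \<in> verts G" "v \<in> verts G" for u v
  proof -
    have "F u \<in> verts H" "F v \<in> verts H" "F u = F v \<longleftrightarrow> u = v"
      using uv bij_betwE[OF F] bij_betw_imp_inj_on[OF F] by (auto simp: inj_on_eq_iff)
    then show ?thesis
      using G'(8)[OF uv] H'(8)[of "F u" "F v"] ST AB uv by simp
  qed
  then show ?thesis
    unfolding graph_iso_def using F by blast
qed

text \<open>Replaces positions on the cycle by a successor permutation. Its last property says that
  the permutation is a single cycle, which makes the counting argument for non-Hamiltonicity
  index-free.\<close>

lemma ham_cycle_successor:
  assumes "hamiltonian G"
  obtains g where "bij_betw g (verts G) (verts G)" "\<And>v. v \<in> verts G \<Longrightarrow> adj G v (g v)"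
    "\<And>T. T \<subseteq> verts G \<Longrightarrow> T \<noteq> {} \<Longrightarrow> g ` T \<subseteq> T \<Longrightarrow> T = verts G"
proof -
  obtain xs where xs: "ham_cycle G xs"
    using assms by (auto simp: hamiltonian_def)
  let ?n = "length xs"
  let ?\<sigma> = "\<lambda>i. Suc i mod ?n"
  let ?f = "\<lambda>i. xs ! i"
  have f: "bij_betw ?f {..<?n} (verts G)"
    using xs by (intro bij_betw_nth) (auto simp: ham_cycle_def ham_path_def)
  have "inj_on ?\<sigma> {..<?n}"
    by (rule inj_onI) (auto simp: mod_Suc split: if_splits)
  moreover have "?\<sigma> ` {..<?n} \<subseteq> {..<?n}"
    by (auto intro: mod_less_divisor)
  ultimately have \<sigma>: "bij_betw ?\<sigma> {..<?n} {..<?n}"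
    by (simp add: bij_betw_def endo_inj_surj)
  define g where "g = ?f \<circ> ?\<sigma> \<circ> inv_into {..<?n} ?f"
  have g: "g (xs ! i) = xs ! (?\<sigma> i)" if "i < ?n" for i
    using that f by (simp add: g_def bij_betw_inv_into_left)
  have V: "\<exists>i < ?n. v = xs ! i" if "v \<in> verts G" for v
    using that f by (auto simp: bij_betw_def)
  show ?thesis
  proof (rule that)
    show "bij_betw g (verts G) (verts G)"
      unfolding g_def by (intro bij_betw_trans[OF bij_betw_inv_into[OF f]] bij_betw_trans[OF \<sigma> f])
    show "adj G v (g v)" if "v \<in> verts G" for v
      using V[OF that] g ham_cycle_nth[OF xs] by auto
    show "T = verts G" if T: "T \<subseteq> verts G" "T \<noteq> {}" "g ` T \<subseteq> T" for T
    proof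
      obtain i where i: "i < ?n" "xs ! i \<in> T"
        using T V by blast
      have step: "xs ! ((i + k) mod ?n) \<in> T" for k
      proof (induction k)
        case (Suc k)
        have "(i + k) mod ?n < ?n"
          using i by (intro mod_less_divisor) linarith
        then show ?case
          using g T(3) Suc by (force simp: mod_Suc_eq)
      qed (use i in simp)
      show "verts G \<subseteq> T"
      proof
        fix v assume "v \<in> verts G"
        then obtain j where j: "j < ?n" "v = xs ! j"
          using V by blast
        \<comment> \<open>Adding the cycle length keeps the number of steps from \<open>i\<close> to
          \<open>j\<close> free of truncation when j < i.\<close>
        have "(i + (?n + j - i)) mod ?n = j"
          using i j by simp
        then show "v \<in> T"
          using step[of "?n + j - i"] j by simp
      qed
    qed (rule T)
  qed
qed

text \<open>Each vertex of \<open>A\<close> has its successor and its predecessor in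
  \<open>S\<close>. The predecessors are as many as \<open>A\<close>, hence exhaust
  \<open>S\<close>, so every successor of an \<open>S\<close>-vertex lies in \<open>A\<close>. Thus
  \<open>S \<union> A\<close> is closed under the successor and the cycle never reaches the
  remaining vertices.\<close>

lemma split_form_nonhamiltonian:
  assumes G: "split_form G S A" and card: "card S = card A" and ne: "A \<noteq> {}" "S \<union> A \<noteq> verts G"
  shows "\<not> hamiltonian G"
proof
  note G' = split_formD[OF G]
  assume "hamiltonian G"
  then obtain g where g: "bij_betw g (verts G) (verts G)" "\<And>v. v \<in> verts G \<Longrightarrow> adj G v (g v)"
    and closed: "\<And>T. T \<subseteq> verts G \<Longrightarrow> T \<noteq> {} \<Longrightarrow> g ` T \<subseteq> T \<Longrightarrow> T = verts G"
    by (rule ham_cycle_successor) blast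
  have gV: "g v \<in> verts G" if "v \<in> verts G" for v
    using g(1) that by (rule bij_betw_apply)
  have inj: "inj_on g (verts G)"
    using g(1) by (rule bij_betw_imp_inj_on)
  have "g ` A \<subseteq> S"
  proof
    fix b assume "b \<in> g ` A"
    then obtain a where "a \<in> A" "b = g a" by blast
    then show "b \<in> S"
      using g(2)[of a] gV[of a] G'(8)[of a b] G'(3,4) by auto
  qed
  \<comment> \<open>The predecessors of \<open>A\<close>: contained in \<open>S\<close> and of the
    same size, they are all of \<open>S\<close>.\<close>
  define B where "B = {v \<in> verts G. g v \<in> A}"
  have "B \<subseteq> S"
  proof
    fix b assume "b \<in> B"
    then show "b \<in> S"
      using g(2)[of b] G'(8)[of b "g b"] gV[of b] G'(4) by (auto simp: B_def)
  qed
  moreover have "g ` B = A"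
    using g(1) G'(3) by (auto simp: B_def bij_betw_def)
  then have "card B = card A"
    using card_image[OF inj_on_subset[OF inj, of B]] by (auto simp: B_def)
  ultimately have "B = S"
    using card card_subset_eq G'(6) by metis
  then have "g ` S \<subseteq> A"
    by (auto simp: B_def)
  with \<open>g ` A \<subseteq> S\<close> have "S \<union> A = verts G"
    using closed[of "S \<union> A"] G'(2,3) ne(1) by blast
  then show False
    using ne(2) by blast
qed

text \<open>Alternating between the two sets, starting and stopping in \<open>S\<close>, uses up one
  more element of \<open>S\<close> than of \<open>J\<close>. Both ends in \<open>S\<close> are what
  allows the list to be attached to an arbitrary path later.\<close>

lemma ex_alternating_list:
  assumes "finite J" "finite S" "card S = Suc (card J)" "S \<inter> J = {}"
    and "\<And>a b. a \<in> S \<Longrightarrow> b \<in> S \<union> J \<Longrightarrow> a \<noteq> b \<Longrightarrow> R a b \<and> R b a"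
  shows "\<exists>xs. distinct xs \<and> set xs = S \<union> J \<and> successively R xs \<and> hd xs \<in> S \<and> last xs \<in> S"
  using assms
proof (induction J arbitrary: S rule: finite_induct)
  case empty
  then obtain a where "S = {a}"
    by (auto simp: card_Suc_eq)
  then show ?case
    by (intro exI[of _ "[a]"]) auto
next
  case (insert j J)
  have cS: "card S = Suc (Suc (card J))"
    using insert by simp
  then obtain a where a: "a \<in> S"
    by fastforce
  have "\<exists>ys. distinct ys \<and> set ys = (S - {a}) \<union> J \<and> successively R ys \<and>
      hd ys \<in> S - {a} \<and> last ys \<in> S - {a}"
    by (rule insert.IH) (use insert.prems a cS in auto)
  then obtain ys where ys: "distinct ys" "set ys = (S - {a}) \<union> J" "successively R ys"
    "hd ys \<in> S - {a}" "last ys \<in> S - {a}"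
    by blast
  have "card (S - {a}) = Suc (card J)"
    using cS a by simp
  then have "S - {a} \<noteq> {}"
    by (metis card.empty nat.distinct(1))
  then have "ys \<noteq> []"
    using ys(2) by auto
  have "R a j" "R j (hd ys)"
    using insert.prems(3,4) a ys(4) by auto
  then have "distinct (a # j # ys) \<and> set (a # j # ys) = S \<union> insert j J \<and>
      successively R (a # j # ys) \<and> hd (a # j # ys) \<in> S \<and> last (a # j # ys) \<in> S"
    using ys insert.prems insert.hyps a \<open>ys \<noteq> []\<close> by (auto simp: successively_Cons)
  then show ?case by blast
qed

text \<open>The alternating list through \<open>S\<close> and \<open>J\<close> ends in dominating
  vertices on both sides, so it closes any path \<open>q\<close> on the remaining vertices. Proving
  Hamiltonicity is thereby reduced to finding \<open>q\<close> with the right leftover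
  count.\<close>

lemma hamiltonianI_join:
  assumes G: "simple_graph G" and V: "verts G = S \<union> J \<union> set q"
    and disj: "S \<inter> J = {}" "(S \<union> J) \<inter> set q = {}"
    and q: "distinct q" "q \<noteq> []" "successively (adj G) q"
    and card: "card S = Suc (card J)"
    and full: "\<And>a b. a \<in> S \<Longrightarrow> b \<in> verts G \<Longrightarrow> a \<noteq> b \<Longrightarrow> adj G a b"
  shows "hamiltonian G"
proof -
  have "finite J" "finite S"
    using G V by (auto simp: simple_graph_def)
  then obtain xs where xs: "distinct xs" "set xs = S \<union> J" "successively (adj G) xs"
    "hd xs \<in> S" "last xs \<in> S"
    using ex_alternating_list[of J S "adj G"] full V disj(1) card adj_sym[of _ _ G] by blast
  have "S \<noteq> {}"
    using card by auto
  then have ne: "xs \<noteq> []"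
    using xs(2) by auto
  have "last q \<in> set q" "hd q \<in> set q"
    using q(2) by simp_all
  then have "hd xs \<noteq> last q" "last xs \<noteq> hd q"
    using disj(2) xs(4,5) by auto
  moreover have "last q \<in> verts G" "hd q \<in> verts G"
    using q(2) V by simp_all
  ultimately have "adj G (hd xs) (last q)" "adj G (last xs) (hd q)"
    using full[OF xs(4), of "last q"] full[OF xs(5), of "hd q"] by simp_all
  then have e: "adj G (last q) (hd xs)" "adj G (last xs) (hd q)"
    by (simp_all add: insert_commute)
  have "ham_cycle G (q @ xs)"
    using q xs ne disj V e
    by (auto simp: ham_cycle_def ham_path_def successively_append_iff)
  then show ?thesis
    by (auto simp: hamiltonian_def)
qed

text \<open>In each case a long path through \<open>x\<close>, \<open>y\<close>, \<open>u\<close>, \<open>w\<close> and the clique outside \<open>S \<union> A\<close> leaves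
  one vertex of \<open>A\<close> fewer than there are dominating vertices, which then close up the cycle.\<close>

lemma hamiltonian_if_kelmans_split_form:
  assumes G: "simple_graph G" and xy: "x \<in> verts G" "y \<in> verts G" "x \<noteq> y"
    and K: "split_form (kelmans G x y) S A" and card: "card S = card A" "S \<union> A \<noteq> verts G"
    and u: "adj G y u" "\<not> adj G x u" "u \<noteq> x" and w: "adj G x w" "\<not> adj G y w" "w \<noteq> y"
  shows "hamiltonian G"
proof -
  let ?K = "kelmans G x y"
  note K' = split_formD[OF K, unfolded verts_kelmans]
  note adj_K = adj_kelmans[OF G xy(3)]
  have uV: "u \<in> verts G" "u \<notin> {x, y}" and wV: "w \<in> verts G" "w \<notin> {x, y}" and "u \<noteq> w"
    using adjD[OF G u(1)] adjD[OF G w(1)] u w by auto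
  have uw': "adj G u y" "adj G w x"
    using u(1) w(1) by (simp_all add: insert_commute)
  have "\<not> adj ?K x u" "\<not> adj ?K x w" "adj ?K y u" "adj ?K y w"
    using adj_K(3,4)[OF uV(2)] adj_K(3,4)[OF wV(2)] u w by auto
  then have out: "x \<notin> S" "u \<notin> S" "w \<notin> S" "x \<in> A \<or> u \<in> A" "x \<in> A \<or> w \<in> A"
    "y \<in> S \<or> y \<notin> A \<and> u \<notin> A \<and> w \<notin> A"
    using K'(8) xy uV wV by auto
  \<comment> \<open>Adjacency to \<open>x\<close> after the operation means being a common neighbour
    of \<open>x\<close> and \<open>y\<close> before it. Hence vertices of \<open>S\<close> other
    than \<open>y\<close> already dominate \<open>G\<close>, including the vertex
    \<open>y\<close>.\<close>
  have full: "adj G a b" if "a \<in> S" "a \<noteq> y" "b \<in> verts G" "a \<noteq> b" for a b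
  proof -
    have a: "a \<notin> {x, y}" "a \<in> verts G" "adj ?K a b"
      using that out K'(2,8) by auto
    consider "b \<notin> {x, y}" | "b = x" | "b = y" by blast
    then show ?thesis
    proof cases
      case 1
      then show ?thesis using a adj_K(1)[OF a(1)] by blast
    next
      case 2
      then show ?thesis using a adj_K(3)[OF a(1)] adj_sym by metis
    next
      case 3
      have "adj ?K x a"
        using K'(8)[OF xy(1) a(2)] that a by auto
      then show ?thesis using 3 adj_K(3)[OF a(1)] adj_sym by metis
    qed
  qed
  have clique: "adj G a b"
    if "a \<in> verts G - S - A - {x, y}" "b \<in> verts G - S - A - {x, y}" "a \<noteq> b" for a b
    using that adj_K(1)[of a b] K'(8)[of a b] by auto
  have either: "adj G x v \<or> adj G y v" if "v \<in> verts G - {x, y}" "adj ?K y v" for v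
    using that adj_K(4)[of v] by auto
  have both: "adj G x v \<and> adj G y v" if "v \<in> verts G - {x, y}" "adj ?K x v" for v
    using that adj_K(3)[of v] by auto
  have finV: "finite (verts G)" and SA: "S \<subseteq> verts G" "A \<subseteq> verts G" "S \<inter> A = {}"
    using K' by auto
  have finSA: "finite S" "finite A"
    using K' by auto
  have list: "\<exists>kk. set kk = B \<and> distinct kk" if "B \<subseteq> verts G" for B
    using finite_distinct_list finite_subset[OF that finV] by blast
  note simps = successively_append_iff successively_Cons hd_append
  \<comment> \<open>These are all cases: if \<open>y\<close> is outside \<open>S\<close>, then
    \<open>u\<close> and \<open>w\<close> are outside \<open>A\<close>, which forces
    \<open>x\<close> into \<open>A\<close>.\<close>
  consider (1) "y \<in> S" "x \<in> A" "A = {x}" | (2) "y \<in> S" "x \<in> A" "A \<noteq> {x}"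
    | (3) "y \<in> S" "x \<notin> A" | (4) "y \<notin> S" "x \<in> A"
    using out by blast
  then show ?thesis
  proof cases
    case 1
    \<comment> \<open>No dominating vertex besides \<open>y\<close> is left to close a path, so the
      cycle is given outright and closed by the edge between \<open>x\<close> and
      \<open>y\<close>.\<close>
    then have "S = {y}"
      using card by (auto simp: card_1_singleton_iff)
    obtain kk where kk: "set kk = verts G - {x, y, u, w}" "distinct kk"
      using list[of "verts G - {x, y, u, w}"] by auto
    have "adj G x y"
      using adj_K(2) K'(8)[OF xy(1,2)] 1(1) xy(3) by simp
    then have "adj G y x"
      by (simp add: insert_commute)
    have "successively (adj G) (w # kk @ [u])"
      by (rule successively_clique)
        (use kk uV wV \<open>u \<noteq> w\<close> 1 \<open>S = {y}\<close> in \<open>auto intro!: clique\<close>)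
    then have "successively (adj G) (x # (w # kk @ [u]) @ [y])"
      using w(1) uw'(1) by (auto simp: simps)
    moreover have "distinct (x # (w # kk @ [u]) @ [y])"
      using kk uV wV \<open>u \<noteq> w\<close> xy(3) by auto
    moreover have "set (x # (w # kk @ [u]) @ [y]) = verts G"
      using kk(1) uV(1) wV(1) xy(1,2) by auto
    ultimately have "ham_cycle G (x # (w # kk @ [u]) @ [y])"
      using \<open>adj G y x\<close> by (simp add: ham_cycle_def ham_path_def)
    then show ?thesis
      by (auto simp: hamiltonian_def)
  next
    case 2
    obtain v where v: "v \<in> verts G - S - A"
      using card SA by blast
    obtain z where z: "z \<in> A" "z \<noteq> x"
      using 2 by blast
    have "adj G x y"
      using adj_K(2) K'(8)[OF xy(1,2)] 2(1) xy(3) by simp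
    then have "adj G y x"
      by (simp add: insert_commute)
    have e: "adj G x a \<or> adj G y a" if "a \<in> verts G - {x, y}" for a
      using either[OF that] K'(8)[of y a] 2(1) that xy by auto
    have "v \<in> verts G - {x, y}" "z \<in> verts G - {x, y}"
      using v z 2 SA by auto
    note e' = e[OF this(1)] e[OF this(2)]
    have uw: "u \<in> A - {x} \<or> u \<in> verts G - S - A" "w \<in> A - {x} \<or> w \<in> verts G - S - A"
      using uV wV out by auto
    \<comment> \<open>One of \<open>x\<close>, \<open>y\<close> needs a neighbour in
      \<open>A\<close> and the other a neighbour in the outer clique. If \<open>u\<close> and
      \<open>w\<close> lie on different sides, they do. If both lie on one side, \<open>v\<close> or
      \<open>z\<close> from the other side is adjacent to \<open>x\<close> or \<open>y\<close>, and
      whichever of \<open>u\<close>, \<open>w\<close> belongs to the remaining vertex completes the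
      choice.\<close>
    have "\<exists>c d p r. c \<in> A - {x} \<and> d \<in> verts G - S - A \<and> (p = x \<and> r = y \<or> p = y \<and> r = x) \<and>
      adj G p c \<and> adj G r d"
      using e' uw u(1) w(1) v z by blast
    then obtain c d p r where cd: "c \<in> A - {x}" "d \<in> verts G - S - A"
      and pr: "p = x \<and> r = y \<or> p = y \<and> r = x" "adj G p c" "adj G r d"
      by blast
    have "adj G c p"
      using pr(2) by (simp_all add: insert_commute)
    obtain kk where kk: "set kk = verts G - S - A - {d}" "distinct kk"
      using list[of "verts G - S - A - {d}"] by auto
    have s: "successively (adj G) (d # kk)"
      by (rule successively_clique) (use kk cd 2 in \<open>auto intro!: clique\<close>)
    show ?thesis
    proof (rule hamiltonianI_join[OF G])
      show "verts G = (S - {y}) \<union> (A - {x, c}) \<union> set (c # p # r # d # kk)"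
        using kk cd pr(1) SA xy by auto
      show "(S - {y}) \<inter> (A - {x, c}) = {}"
        "((S - {y}) \<union> (A - {x, c})) \<inter> set (c # p # r # d # kk) = {}"
        using kk cd pr(1) SA xy 2 by auto
      show "distinct (c # p # r # d # kk)"
        using kk cd pr(1) SA xy 2 by auto
      show "successively (adj G) (c # p # r # d # kk)"
        using s pr(1,3) \<open>adj G y x\<close> \<open>adj G x y\<close> \<open>adj G c p\<close> by (auto simp: simps)
      have "card {x, c} = 2"
        using cd by auto
      moreover have "card A \<ge> 2"
        using card_mono[of A "{x, c}"] cd 2 finSA by auto
      ultimately show "card (S - {y}) = Suc (card (A - {x, c}))"
        using 2 cd finSA card by (simp add: card_Diff_subset)
    qed (use full in auto)
  next
    case 3
    then have uwA: "u \<in> A" "w \<in> A"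
      using out by auto
    obtain kk where kk: "set kk = verts G - S - A - {x}" "distinct kk"
      using list[of "verts G - S - A - {x}"] by auto
    have "adj G x y"
      using adj_K(2) K'(8)[OF xy(1,2)] 3 xy by auto
    \<comment> \<open>Here \<open>x\<close> sits in the outer clique, so its clique neighbours after
      the operation were common neighbours of \<open>x\<close> and \<open>y\<close>. Thus
      \<open>x\<close>, \<open>y\<close> and the rest of that clique form a clique of
      \<open>G\<close>, entered from \<open>w\<close> at \<open>x\<close> and left from
      \<open>y\<close> to \<open>u\<close>.\<close>
    have b: "adj G x a" "adj G y a" if "a \<in> set kk" for a
      using both[of a] that kk K'(8)[of x a] out xy 3 by auto
    have pairs: "adj G a a'"
      if aa: "a \<in> set (x # kk @ [y])" "a' \<in> set (x # kk @ [y])" "a \<noteq> a'" for a a'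
    proof -
      consider "a \<in> set kk" "a' \<in> set kk" | "a \<in> {x, y}" "a' \<in> set kk" | "a \<in> set kk" "a' \<in> {x, y}"
        | "a \<in> {x, y}" "a' \<in> {x, y}"
        using aa by auto
      then show ?thesis
      proof cases
        case 1
        then show ?thesis using clique aa(3) kk 3 by auto
      next
        case 2
        then show ?thesis using b by auto
      next
        case c: 3
        then have "adj G a' a" using b by auto
        then show ?thesis by (simp add: insert_commute)
      next
        case 4
        then show ?thesis using \<open>adj G x y\<close> aa(3) by (auto simp: insert_commute)
      qed
    qed
    have "distinct (x # kk @ [y])"
      using kk xy 3 by auto
    then have s: "successively (adj G) (x # kk @ [y])"
      using pairs by (rule successively_clique)
    show ?thesis
    proof (rule hamiltonianI_join[OF G])
      show "verts G = (S - {y}) \<union> (A - {u, w}) \<union> set (w # (x # kk @ [y]) @ [u])"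
        using kk uV wV SA xy by auto
      show "(S - {y}) \<inter> (A - {u, w}) = {}"
        "((S - {y}) \<union> (A - {u, w})) \<inter> set (w # (x # kk @ [y]) @ [u]) = {}"
        using kk SA uwA out 3 by auto
      show "distinct (w # (x # kk @ [y]) @ [u])"
        using kk uwA uV wV xy SA 3 \<open>u \<noteq> w\<close> by auto
      show "successively (adj G) (w # (x # kk @ [y]) @ [u])"
        using s u(1) uw' by (auto simp: simps)
      have "card A \<ge> 2"
        using card_mono[of A "{u, w}"] uwA finSA \<open>u \<noteq> w\<close> by auto
      then show "card (S - {y}) = Suc (card (A - {u, w}))"
        using 3 uwA finSA card \<open>u \<noteq> w\<close> by (simp add: card_Diff_subset)
    qed (use full in auto)
  next
    case 4
    then have uwA: "u \<notin> A" "w \<notin> A" "y \<notin> A"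
      using out by auto
    obtain kk where kk: "set kk = verts G - S - A - {y, u, w}" "distinct kk"
      using list[of "verts G - S - A - {y, u, w}"] by auto
    \<comment> \<open>Now \<open>u\<close>, \<open>w\<close> and \<open>y\<close> lie in the outer
      clique. The path is routed through the private neighbours, x to w and u to y, since adjacency
      of \<open>x\<close> or \<open>y\<close> to other clique vertices is not known
      individually.\<close>
    have s: "successively (adj G) (w # kk @ [u])"
      by (rule successively_clique)
        (use kk uV wV \<open>u \<noteq> w\<close> uwA out 4 in \<open>auto intro!: clique\<close>)
    show ?thesis
    proof (rule hamiltonianI_join[OF G])
      show "verts G = S \<union> (A - {x}) \<union> set (x # (w # kk @ [u]) @ [y])"
        using kk uV wV SA xy by auto
      show "S \<inter> (A - {x}) = {}" "(S \<union> (A - {x})) \<inter> set (x # (w # kk @ [u]) @ [y]) = {}"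
        using kk SA uwA out 4 by auto
      show "distinct (x # (w # kk @ [u]) @ [y])"
        using kk uwA uV wV xy SA 4 \<open>u \<noteq> w\<close> by auto
      show "successively (adj G) (x # (w # kk @ [u]) @ [y])"
        using s w(1) uw' by (auto simp: simps)
      have "card A \<ge> 1"
        using 4 finSA by (auto simp: Suc_le_eq card_gt_0_iff)
      then show "card S = Suc (card (A - {x}))"
        using 4 finSA card by simp
    qed (use full 4 in auto)
  qed
qed

section \<open>Pulling the split form back through a Kelmans operation\<close>

lemma split_form_of_iso:
  assumes K: "split_form K S A" and iso: "graph_iso K G" and G: "simple_graph G"
  obtains T B where "split_form G T B" "card T = card S" "card B = card A"
proof -
  note K' = split_formD[OF K]
  obtain f where f: "bij_betw f (verts K) (verts G)"
    and e: "\<forall>u \<in> verts K. \<forall>v \<in> verts K. adj K u v \<longleftrightarrow> adj G (f u) (f v)"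
    using iso by (auto simp: graph_iso_def)
  have inj: "inj_on f (verts K)" and im: "f ` verts K = verts G"
    using f by (auto simp: bij_betw_def)
  have mem: "f u \<in> f ` S \<longleftrightarrow> u \<in> S" "f u \<in> f ` A \<longleftrightarrow> u \<in> A" if "u \<in> verts K" for u
    using inj_on_image_mem_iff[OF inj that] K'(2,3) by auto
  show ?thesis
  proof (rule that)
    show "split_form G (f ` S) (f ` A)"
      unfolding split_form_def
    proof (intro conjI ballI)
      show "f ` S \<subseteq> verts G" "f ` A \<subseteq> verts G"
        using K'(2,3) im by auto
      show "f ` S \<inter> f ` A = {}"
        using K'(2,3,4) inj_on_image_Int[OF inj, of S A] by simp
      fix p q assume "p \<in> verts G" "q \<in> verts G"
      then obtain u v where uv: "u \<in> verts K" "v \<in> verts K" "p = f u" "q = f v"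
        using im by blast
      then have "p = q \<longleftrightarrow> u = v"
        using inj by (auto simp: inj_on_eq_iff)
      then show "adj G p q \<longleftrightarrow> p \<noteq> q \<and> (p \<in> f ` S \<or> q \<in> f ` S \<or> p \<notin> f ` A \<and> q \<notin> f ` A)"
        using e uv mem[OF uv(1)] mem[OF uv(2)] K'(8)[OF uv(1,2)] by simp
    qed (rule G)
    show "card (f ` S) = card S" "card (f ` A) = card A"
      using card_image inj_on_subset[OF inj] K'(2,3) by blast+
  qed
qed

text \<open>In the first alternative no neighbour is moved. In the second the intersection is the
  neighbourhood of \<open>y\<close> and the union that of \<open>x\<close>, up to \<open>x\<close>
  and \<open>y\<close> themselves, so the transposition of the two vertices is an
  isomorphism.\<close>

lemma split_form_of_kelmans:
  assumes G: "simple_graph G" and xy: "x \<in> verts G" "y \<in> verts G" "x \<noteq> y"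
    and K: "split_form (kelmans G x y) S A"
    and dom: "(\<forall>w. adj G x w \<longrightarrow> w \<noteq> y \<longrightarrow> adj G y w) \<or> (\<forall>u. adj G y u \<longrightarrow> u \<noteq> x \<longrightarrow> adj G x u)"
  obtains T B where "split_form G T B" "card T = card S" "card B = card A"
  using dom
proof
  assume "\<forall>w. adj G x w \<longrightarrow> w \<noteq> y \<longrightarrow> adj G y w"
  then have W: "neighbors G x - (neighbors G y \<union> {y}) = {}"
    by (auto simp: neighbors_def)
  have "kelmans G x y = G"
    unfolding kelmans_def Let_def W by simp
  then show ?thesis
    using that K by auto
next
  assume dom: "\<forall>u. adj G y u \<longrightarrow> u \<noteq> x \<longrightarrow> adj G x u"
  let ?K = "kelmans G x y"
  define \<tau> where "\<tau> v = (if v = x then y else if v = y then x else v)" for v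
  have \<tau>: "bij_betw \<tau> (verts G) (verts G)"
    by (rule bij_betw_byWitness[of _ \<tau>]) (use xy in \<open>auto simp: \<tau>_def\<close>)
  have KG: "simple_graph ?K"
    using simple_graph_kelmans[OF G xy(2)] .
  note adj_K = adj_kelmans[OF G xy(3)]
  have e: "adj ?K u v \<longleftrightarrow> adj G (\<tau> u) (\<tau> v)" for u v
  proof -
    consider "u = v" | "u \<notin> {x, y}" "v \<notin> {x, y}" | "u = x" "v \<notin> {x, y}" | "u = y" "v \<notin> {x, y}"
      | "v = x" "u \<notin> {x, y}" | "v = y" "u \<notin> {x, y}" | "u = x" "v = y" | "u = y" "v = x"
      by blast
    then show ?thesis
    proof cases
      case 1
      then show ?thesis using adjD(3)[OF G] adjD(3)[OF KG] by blast
    next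
      case 2
      then show ?thesis using adj_K(1) by (simp add: \<tau>_def)
    next
      case 3
      then show ?thesis using adj_K(3)[of v] dom xy(3) by (auto simp: \<tau>_def)
    next
      case 4
      then show ?thesis using adj_K(4)[of v] dom xy(3) by (auto simp: \<tau>_def)
    next
      case 5
      have "adj ?K x u \<longleftrightarrow> adj G y u"
        using 5 adj_K(3)[of u] dom by auto
      then show ?thesis using 5 xy(3) by (simp add: \<tau>_def insert_commute)
    next
      case 6
      have "adj ?K y u \<longleftrightarrow> adj G x u"
        using 6 adj_K(4)[of u] dom by auto
      then show ?thesis using 6 xy(3) by (simp add: \<tau>_def insert_commute)
    next
      case 7
      then show ?thesis using adj_K(2) xy(3) by (simp add: \<tau>_def insert_commute)
    next
      case 8
      then show ?thesis using adj_K(2) xy(3) by (simp add: \<tau>_def insert_commute)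
    qed
  qed
  have "graph_iso ?K G"
    unfolding graph_iso_def verts_kelmans using \<tau> e by blast
  then show ?thesis
    using split_form_of_iso[OF K _ G] that by blast
qed

section \<open>Compressing a set of low-degree vertices\<close>

lemma degree_kelmans:
  assumes G: "simple_graph G" and xy: "x \<in> verts G" "y \<in> verts G" "x \<noteq> y"
  defines "W \<equiv> neighbors G x - (neighbors G y \<union> {y})"
  shows "degree (kelmans G x y) x + card W = degree G x"
    and "degree (kelmans G x y) y = degree G y + card W"
    and "v \<notin> {x, y} \<Longrightarrow> degree (kelmans G x y) v = degree G v"
proof -
  let ?K = "kelmans G x y"
  note adj_K = adj_kelmans[OF G xy(3)]
  have K: "simple_graph ?K"
    using simple_graph_kelmans[OF G xy(2)] .
  note irr = adjD(3)[OF G] adjD(3)[OF K]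
  have fin: "finite W"
    unfolding W_def using finite_neighbors[OF G] by blast
  have "neighbors ?K x = neighbors G x - W"
  proof (rule set_eqI)
    fix v
    show "v \<in> neighbors ?K x \<longleftrightarrow> v \<in> neighbors G x - W"
      using adj_K(2) adj_K(3)[of v] irr(1)[of x x] irr(2)[of x x]
      by (cases "v = x"; cases "v = y") (auto simp: neighbors_def W_def)
  qed
  moreover have "W \<subseteq> neighbors G x"
    by (auto simp: W_def)
  ultimately show "degree ?K x + card W = degree G x"
    using card_mono[OF finite_neighbors[OF G] \<open>W \<subseteq> neighbors G x\<close>] fin
    by (simp add: degree_def card_Diff_subset)
  have "neighbors ?K y = neighbors G y \<union> W"
  proof (rule set_eqI)
    fix v
    have "adj ?K y x \<longleftrightarrow> adj G y x"
      using adj_K(2) by (simp add: insert_commute)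
    then show "v \<in> neighbors ?K y \<longleftrightarrow> v \<in> neighbors G y \<union> W"
      using adj_K(4)[of v] irr(1)[of y y] irr(2)[of y y] irr(1)[of x x] xy(3)
      by (cases "v = x"; cases "v = y") (auto simp: neighbors_def W_def)
  qed
  moreover have "neighbors G y \<inter> W = {}"
    by (auto simp: W_def)
  ultimately show "degree ?K y = degree G y + card W"
    using fin finite_neighbors[OF G] by (simp add: degree_def card_Un_disjoint)
  assume v: "v \<notin> {x, y}"
  have x: "adj ?K v x \<longleftrightarrow> adj G v x \<and> adj G v y" and y: "adj ?K v y \<longleftrightarrow> adj G v x \<or> adj G v y"
    using adj_K(3,4)[OF v] by (simp_all add: insert_commute)
  have "neighbors ?K v - {x, y} = neighbors G v - {x, y}"
    using adj_K(1)[OF v] by (auto simp: neighbors_def)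
  \<comment> \<open>Replacing two adjacencies by their conjunction and disjunction preserves how
    many of them hold.\<close>
  moreover have "card (neighbors ?K v \<inter> {x, y}) = card (neighbors G v \<inter> {x, y})"
  proof -
    have "neighbors H v \<inter> {x, y} = (if adj H v x then {x} else {}) \<union> (if adj H v y then {y} else {})"
      for H by (auto simp: neighbors_def)
    then show ?thesis
      using x y xy(3) by simp
  qed
  moreover have "card N = card (N - {x, y}) + card (N \<inter> {x, y})" if "finite N" for N
    using card_Int_Diff[OF that, of "{x, y}"] by simp
  ultimately show "degree ?K v = degree G v"
    unfolding degree_def using finite_neighbors[OF G] finite_neighbors[OF K] by metis
qed

definition kelmans_step :: "'a graph \<Rightarrow> 'a graph \<Rightarrow> bool" where
  "kelmans_step G H \<longleftrightarrow> (\<exists>x \<in> verts G. \<exists>y \<in> verts G. x \<noteq> y \<and> H = kelmans G x y)"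

lemma kelmans_steps_simple:
  assumes "kelmans_step\<^sup>*\<^sup>* G H" "simple_graph G"
  shows "simple_graph H \<and> verts H = verts G"
  using assms
proof induction
  case (step H J)
  then obtain x y where "J = kelmans H x y" "y \<in> verts H"
    by (auto simp: kelmans_step_def)
  then show ?case
    using step simple_graph_kelmans[of H y x] by simp
qed simp

definition split_graph :: "'a set \<Rightarrow> 'a set \<Rightarrow> 'a set \<Rightarrow> 'a graph" where
  "split_graph V S A = Graph V {{u, v} |u v. u \<in> V \<and> v \<in> V \<and> u \<noteq> v \<and>
     (u \<in> S \<or> v \<in> S \<or> (u \<notin> A \<and> v \<notin> A))}"

lemma split_form_split_graph:
  assumes "finite V" "S \<subseteq> V" "A \<subseteq> V" "S \<inter> A = {}"
  shows "split_form (split_graph V S A) S A"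
proof -
  have "simple_graph (split_graph V S A)"
    by (rule simple_graphI) (use assms in \<open>auto simp: split_graph_def\<close>)
  moreover have "adj (split_graph V S A) u v \<longleftrightarrow> u \<noteq> v \<and> (u \<in> S \<or> v \<in> S \<or> u \<notin> A \<and> v \<notin> A)"
    if "u \<in> V" "v \<in> V" for u v
    using that unfolding split_graph_def graph.sel mem_Collect_eq doubleton_eq_iff by metis
  ultimately show ?thesis
    unfolding split_form_def using assms by (simp add: split_graph_def)
qed

text \<open>Kelmans operations from lighter to heavier vertices for a weight \<open>r\<close> that vanishes on \<open>A\<close> and
  is injective elsewhere never raise a degree inside \<open>A\<close>, and every effective one increases the
  weighted degree sum. Once none is effective, an edge inside \<open>A\<close> would join its ends to all of
  \<open>V - A\<close>, and the neighbourhood of a vertex of \<open>A\<close> is an upper segment of \<open>V - A\<close>.\<close>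

lemma kelmans_steps_to_split:
  assumes G: "simple_graph G" and A: "A \<subseteq> verts G" "card A + t \<le> card (verts G)"
    and deg: "\<And>v. v \<in> A \<Longrightarrow> degree G v \<le> t"
  obtains M S where "kelmans_step\<^sup>*\<^sup>* G M" "S \<subseteq> verts G - A" "card S = t"
    "edges M \<subseteq> edges (split_graph (verts G) S A)"
proof -
  let ?V = "verts G"
  let ?B = "?V - A"
  let ?m = "card ?B"
  have fin: "finite ?V" "finite A" "finite ?B"
    using G A by (auto simp: simple_graph_def intro: finite_subset)
  have m: "?m = card ?V - card A"
    using fin A by (simp add: card_Diff_subset)
  obtain h where h: "bij_betw h ?B {0..<?m}"
    using ex_bij_betw_finite_nat[OF fin(3)] by blast
  \<comment> \<open>The successor makes every weight outside \<open>A\<close> positive, hence larger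
    than the weight on \<open>A\<close>; \<open>h\<close> ranks the vertices outside
    \<open>A\<close> without ties.\<close>
  define r where "r v = (if v \<in> A then 0 else Suc (h v))" for v
  define \<Phi> where "\<Phi> H = (\<Sum>v\<in>?V. r v * degree H v)" for H
  let ?Q = "\<lambda>H. kelmans_step\<^sup>*\<^sup>* G H \<and> (\<forall>v \<in> A. degree H v \<le> t)"
  have "\<forall>H. ?Q H \<longrightarrow> \<Phi> H < Suc (\<Sum>v\<in>?V. r v * card ?V)"
  proof (intro allI impI)
    fix H assume "?Q H"
    then have "simple_graph H" "verts H = ?V"
      using kelmans_steps_simple[OF _ G, of H] by blast+
    then have "\<Phi> H \<le> (\<Sum>v\<in>?V. r v * card ?V)"
      unfolding \<Phi>_def by (intro sum_mono mult_left_mono) (use degree_le_card[of H] in auto)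
    then show "\<Phi> H < Suc (\<Sum>v\<in>?V. r v * card ?V)" by simp
  qed
  moreover have "?Q G"
    using deg by simp
  ultimately obtain M where M: "?Q M" and max: "\<forall>H. ?Q H \<longrightarrow> \<Phi> H \<le> \<Phi> M"
    using ex_has_greatest_nat[of ?Q G \<Phi>] by blast
  have sM: "simple_graph M" and VM: "verts M = ?V"
    using M kelmans_steps_simple[OF _ G, of M] by blast+
  \<comment> \<open>At a maximum of \<Phi> a heavier vertex inherits all neighbours of a lighter
    one, since otherwise the operation from the lighter to the heavier would increase \<Phi> by (r y
    - r x) * card W, where W is the set of moved neighbours.\<close>
  have dom: "adj M y w" if xy: "x \<in> ?V" "y \<in> ?V" "r x < r y" and w: "adj M x w" "w \<noteq> y" for x y w
  proof (rule ccontr)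
    assume nw: "\<not> adj M y w"
    let ?K = "kelmans M x y"
    let ?W = "neighbors M x - (neighbors M y \<union> {y})"
    have "x \<noteq> y"
      using xy(3) by auto
    note d = degree_kelmans[OF sM xy(1,2)[folded VM] \<open>x \<noteq> y\<close>]
    have "y \<notin> A"
      using xy(3) by (auto simp: r_def)
    have "w \<in> ?W"
      using w nw by (auto simp: neighbors_def)
    then have W: "card ?W > 0"
      using finite_neighbors[OF sM] by (auto simp: card_gt_0_iff)
    \<comment> \<open>The heavier vertex \<open>y\<close> is outside \<open>A\<close>, so the only
      degree in \<open>A\<close> that can change is that of \<open>x\<close>, and it drops.\<close>
    have "degree ?K v \<le> t" if "v \<in> A" for v
    proof (cases "v = x")
      case True
      have "degree M x \<le> t"
        using M that True by blast
      then show ?thesis using d(1) unfolding True by linarith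
    next
      case False
      moreover have "v \<noteq> y" "degree M v \<le> t"
        using M that \<open>y \<notin> A\<close> by blast+
      ultimately show ?thesis using d(3)[of v] by simp
    qed
    moreover have "kelmans_step M ?K"
      using xy VM \<open>x \<noteq> y\<close> by (auto simp: kelmans_step_def)
    ultimately have "?Q ?K"
      using M by (auto intro: rtranclp.rtrancl_into_rtrancl)
    then have le: "\<Phi> ?K \<le> \<Phi> M"
      using max by blast
    have split: "\<Phi> H = r x * degree H x + (r y * degree H y + (\<Sum>v\<in>?V - {x} - {y}. r v * degree H v))"
      for H
      unfolding \<Phi>_def using fin xy \<open>x \<noteq> y\<close>
      by (subst sum.remove[of _ x], simp, simp, subst sum.remove[of _ y]) auto
    have rest: "(\<Sum>v\<in>?V - {x} - {y}. r v * degree ?K v) = (\<Sum>v\<in>?V - {x} - {y}. r v * degree M v)"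
      by (rule sum.cong) (use d(3) in auto)
    have "r x * degree M x = r x * degree ?K x + r x * card ?W"
      using d(1) by (metis distrib_left)
    moreover have "r y * degree ?K y = r y * degree M y + r y * card ?W"
      using d(2) by (metis distrib_left)
    moreover have "r x * card ?W < r y * card ?W"
      using W xy(3) by simp
    ultimately show False
      using le unfolding split rest by linarith
  qed
  \<comment> \<open>The \<open>t\<close> heaviest vertices outside \<open>A\<close>, written
    additively to avoid truncated subtraction.\<close>
  define S where "S = {b \<in> ?B. ?m \<le> h b + t}"
  have SB: "S \<subseteq> ?B"
    by (auto simp: S_def)
  have tm: "t \<le> ?m"
    using A m by simp
  have "h ` S = {?m - t..<?m}"
  proof
    show "h ` S \<subseteq> {?m - t..<?m}"
      using bij_betw_apply[OF h] by (fastforce simp: S_def)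
    show "{?m - t..<?m} \<subseteq> h ` S"
    proof
      fix i assume i: "i \<in> {?m - t..<?m}"
      then have "i \<in> h ` ?B"
        using h by (auto simp: bij_betw_def)
      then show "i \<in> h ` S"
        using i by (auto simp: S_def)
    qed
  qed
  then have cardS: "card S = t"
    using card_image[OF inj_on_subset[OF bij_betw_imp_inj_on[OF h] SB]] tm by simp
  have indep: "\<not> adj M x x'" if xx': "x \<in> A" "x' \<in> A" for x x'
  proof
    assume e: "adj M x x'"
    have "adj M x' b" if "b \<in> insert x ?B" for b
    proof (cases "b = x")
      case True
      then show ?thesis using e by (simp add: insert_commute)
    next
      case False
      then have "adj M b x'"
        using dom[of x b x'] e xx' A that by (auto simp: r_def)
      then show ?thesis by (simp add: insert_commute)
    qed
    \<comment> \<open>Since \<open>t\<close> is at most the number of vertices outside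
      \<open>A\<close>, these together with \<open>x\<close> are too many neighbours.\<close>
    then have "card (insert x ?B) \<le> degree M x'"
      unfolding degree_def by (intro card_mono finite_neighbors sM) (auto simp: neighbors_def)
    moreover have "card (insert x ?B) = Suc ?m"
      using fin xx' by simp
    ultimately show False
      using M xx' tm by (metis Suc_n_not_le_n le_trans)
  qed
  have nbrs: "b \<in> S" if "x \<in> A" "adj M x b" for x b
  proof (rule ccontr)
    assume b: "b \<notin> S"
    have "b \<in> ?B"
      using indep[of x b] that adjD(2)[OF sM, of x b] VM by auto
    then have hb: "h b + t < ?m"
      using b by (auto simp: S_def)
    have "adj M x c" if c: "c \<in> S" for c
    proof -
      have "c \<in> ?B" "h b < h c"
        using c hb by (auto simp: S_def)
      moreover have "adj M b x"
        using \<open>adj M x b\<close> by (simp add: insert_commute)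
      ultimately have "adj M c x"
        using dom[of b c x] \<open>b \<in> ?B\<close> \<open>x \<in> A\<close> by (auto simp: r_def)
      then show ?thesis by (simp add: insert_commute)
    qed
    \<comment> \<open>The \<open>t\<close> vertices of \<open>S\<close> and the lighter
      \<open>b\<close> would be t + 1 neighbours of \<open>x\<close>.\<close>
    then have "card (insert b S) \<le> degree M x"
      unfolding degree_def using that(2)
      by (intro card_mono finite_neighbors sM) (auto simp: neighbors_def)
    moreover have "card (insert b S) = Suc t"
      using b cardS finite_subset[OF SB fin(3)] by simp
    ultimately show False
      using M that(1) by (metis Suc_n_not_le_n le_trans)
  qed
  have "edges M \<subseteq> edges (split_graph ?V S A)"
  proof (rule edges_subsetI[OF sM])
    fix u v assume e: "adj M u v"
    then have "adj M v u" by (simp add: insert_commute)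
    then have "u \<in> S \<or> v \<in> S \<or> u \<notin> A \<and> v \<notin> A"
      using e nbrs by blast
    then show "adj (split_graph ?V S A) u v"
      using adjD[OF sM e] VM by (auto simp: split_graph_def)
  qed
  then show ?thesis
    using that M SB cardS by blast
qed

section \<open>Adding a dominating vertex\<close>

text \<open>The join with a single vertex, but with the old vertices keeping their names, unlike
  \<open>join\<close>. Kelmans operations on old vertices can thus be compared literally in both
  graphs.\<close>

definition cone :: "'a \<Rightarrow> 'a graph \<Rightarrow> 'a graph" where
  "cone z G = Graph (insert z (verts G)) (edges G \<union> {{z, v} |v. v \<in> verts G})"

lemma verts_cone [simp]: "verts (cone z G) = insert z (verts G)"
  by (simp add: cone_def)

lemma simple_graph_cone:
  assumes "simple_graph G" "z \<notin> verts G"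
  shows "simple_graph (cone z G)"
proof (rule simple_graphI)
  fix e assume "e \<in> edges (cone z G)"
  then consider "e \<in> edges G" | v where "e = {z, v}" "v \<in> verts G"
    by (auto simp: cone_def)
  then show "\<exists>u v. e = {u, v} \<and> u \<in> verts (cone z G) \<and> v \<in> verts (cone z G) \<and> u \<noteq> v"
  proof cases
    case 1
    then show ?thesis
      using edge_pair[OF assms(1)] by (metis insertCI verts_cone)
  next
    case 2
    then show ?thesis
      using assms(2) by auto
  qed
qed (use assms in \<open>simp add: simple_graph_def\<close>)

lemma adj_cone:
  assumes "simple_graph G" "z \<notin> verts G"
  shows "u \<noteq> z \<Longrightarrow> v \<noteq> z \<Longrightarrow> adj (cone z G) u v \<longleftrightarrow> adj G u v"
    and "adj (cone z G) z v \<longleftrightarrow> v \<in> verts G"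
    and "adj (cone z G) v z \<longleftrightarrow> v \<in> verts G"
  using assms(2) adjD(1)[OF assms(1), of z v] adjD(2)[OF assms(1), of v z]
  by (auto simp: cone_def doubleton_eq_iff)

lemma neighbors_cone:
  assumes G: "simple_graph G" and z: "z \<notin> verts G" and v: "v \<in> verts G"
  shows "neighbors (cone z G) v = insert z (neighbors G v)"
proof (rule set_eqI)
  fix w
  show "w \<in> neighbors (cone z G) v \<longleftrightarrow> w \<in> insert z (neighbors G v)"
    using adj_cone(1)[OF G z, of v w] adj_cone(3)[OF G z, of v] v z
    by (cases "w = z"; cases "v = z") (auto simp: neighbors_def)
qed

lemma degree_cone:
  assumes G: "simple_graph G" and z: "z \<notin> verts G"
  shows "v \<in> verts G \<Longrightarrow> degree (cone z G) v = Suc (degree G v)"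
    and "degree (cone z G) z = card (verts G)"
proof -
  assume v: "v \<in> verts G"
  have "z \<notin> neighbors G v"
    using neighbors_subset[OF G, of v] z by blast
  then show "degree (cone z G) v = Suc (degree G v)"
    using finite_neighbors[OF G] by (simp add: degree_def neighbors_cone[OF G z v])
next
  have "neighbors (cone z G) z = verts G"
    using adj_cone(2)[OF G z] by (auto simp: neighbors_def)
  then show "degree (cone z G) z = card (verts G)"
    by (simp add: degree_def)
qed

lemma hamiltonian_cone_iff:
  assumes G: "simple_graph G" and z: "z \<notin> verts G" and ne: "verts G \<noteq> {}"
  shows "hamiltonian (cone z G) \<longleftrightarrow> (\<exists>p. ham_path G p)"
proof
  assume "hamiltonian (cone z G)"
  then obtain p where p: "ham_cycle (cone z G) (z # p)"
    by (rule ham_cycle_rotate) auto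
  then have set: "distinct p" "set p = verts G" "z \<notin> set p"
    using z by (auto simp: ham_cycle_def ham_path_def)
  have "successively (adj (cone z G)) p"
    using p by (auto simp: ham_cycle_def ham_path_def successively_Cons)
  then have "successively (adj G) p"
  proof (rule successively_mono)
    show "adj G a b" if "a \<in> set p" "b \<in> set p" "adj (cone z G) a b" for a b
      using that adj_cone(1)[OF G z, of a b] set by metis
  qed
  then show "\<exists>p. ham_path G p"
    using set by (auto simp: ham_path_def)
next
  assume "\<exists>p. ham_path G p"
  then obtain p where p: "distinct p" "set p = verts G" "successively (adj G) p"
    by (auto simp: ham_path_def)
  have "p \<noteq> []"
    using p ne by auto
  then have "hd p \<in> verts G" "last p \<in> verts G"
    using hd_in_set[of p] last_in_set[of p] p(2) by auto
  moreover have "successively (adj (cone z G)) p"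
    using p(3) by (rule successively_mono) (simp add: cone_def)
  ultimately have "ham_cycle (cone z G) (z # p)"
    using p z \<open>p \<noteq> []\<close> adj_cone(2,3)[OF G z]
    by (simp add: ham_cycle_def ham_path_def successively_Cons)
  then show "hamiltonian (cone z G)"
    by (auto simp: hamiltonian_def)
qed

text \<open>The apex is adjacent to both \<open>x\<close> and \<open>y\<close>, so it is never among
  the moved neighbours.\<close>

lemma kelmans_cone:
  assumes G: "simple_graph G" and z: "z \<notin> verts G"
    and xy: "x \<in> verts G" "y \<in> verts G" "x \<noteq> y"
  shows "kelmans (cone z G) x y = cone z (kelmans G x y)"
proof -
  let ?W = "neighbors G x - (neighbors G y \<union> {y})"
  let ?C = "{{z, v} |v. v \<in> verts G}" and ?X = "{{x, w} |w. w \<in> ?W}"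
    and ?Y = "{{y, w} |w. w \<in> ?W}"
  have "z \<noteq> y"
    using z xy by auto
  then have W: "neighbors (cone z G) x - (neighbors (cone z G) y \<union> {y}) = ?W"
    unfolding neighbors_cone[OF G z xy(1)] neighbors_cone[OF G z xy(2)]
    using neighbors_subset[OF G, of x] z by blast
  have "z \<noteq> x" "z \<notin> ?W"
    using z xy neighbors_subset[OF G, of x] by auto
  then have "?C \<inter> ?X = {}"
    by (auto simp: doubleton_eq_iff)
  then have "(edges G \<union> ?C) - ?X \<union> ?Y = (edges G - ?X \<union> ?Y) \<union> ?C"
    by blast
  then show ?thesis
    unfolding kelmans_def Let_def W by (simp add: cone_def)
qed

text \<open>The apex joins the dominating part. The sizes (s - 1, s) of the path case thereby become
  the balanced sizes (s, s) of the cycle case.\<close>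

lemma split_form_cone:
  assumes "split_form G S A" and z: "z \<notin> verts G"
  shows "split_form (cone z G) (insert z S) A"
proof -
  note G' = split_formD[OF assms(1)]
  have "adj (cone z G) u v \<longleftrightarrow>
      u \<noteq> v \<and> (u \<in> insert z S \<or> v \<in> insert z S \<or> u \<notin> A \<and> v \<notin> A)"
    if "u \<in> insert z (verts G)" "v \<in> insert z (verts G)" for u v
    using that adj_cone[OF G'(1) z] G'(8)[of u v] z G'(2,3)
      adjD(3)[OF simple_graph_cone[OF G'(1) z], of z z]
    by (cases "u = z"; cases "v = z") auto
  then show ?thesis
    unfolding split_form_def using simple_graph_cone[OF G'(1) z] G'(2-4) z by auto
qed

section \<open>Comparison with the extremal graphs\<close>

text \<open>Any vertex of \<open>S\<close> is a hub. This provides the connectedness that the strict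
  feasibility axiom demands of the larger graph.\<close>

lemma split_form_connected:
  assumes "split_form G S A" "S \<noteq> {}"
  shows "connected_graph G"
proof -
  note G' = split_formD[OF assms(1)]
  obtain s where s: "s \<in> S" "s \<in> verts G"
    using assms(2) G'(2) by blast
  let ?R = "{(u, v). adj G u v}"
  have "(u, s) \<in> ?R\<^sup>* \<and> (s, u) \<in> ?R\<^sup>*" if "u \<in> verts G" for u
    using G'(8)[OF that s(2)] G'(8)[OF s(2) that] s(1) by (cases "u = s") auto
  then show ?thesis
    unfolding connected_graph_def using s(2) by (blast intro: rtrancl_trans)
qed

lemma split_form_min_degree:
  assumes G: "split_form G S A" and ne: "A \<noteq> {}" and k: "k \<le> card S"
    and rest: "S \<union> A \<noteq> verts G"
  shows "k \<le> min_degree G"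
proof -
  note G' = split_formD[OF G]
  have "k \<le> degree G v" if v: "v \<in> verts G" for v
  proof (cases "v \<in> S")
    case True
    \<comment> \<open>A vertex of \<open>S\<close> is adjacent to all others, and since
      \<open>A\<close> is nonempty there are at least \<open>card S\<close> others.\<close>
    have "card (insert v (neighbors G v)) \<ge> card (insert v (verts G))"
      by (rule card_mono) (use True v G' finite_neighbors[OF G'(1)] in \<open>auto simp: neighbors_def\<close>)
    moreover have "card (verts G) \<ge> card (S \<union> A)"
      by (rule card_mono) (use G' in auto)
    moreover have "card (S \<union> A) = card S + card A" "card A > 0"
      using G' ne by (auto simp: card_Un_disjoint card_gt_0_iff)
    ultimately show ?thesis
      using k v finite_neighbors[OF G'(1)]
      by (auto simp: degree_def insert_absorb card_insert_if split: if_splits)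
  next
    case False
    then have "S \<subseteq> neighbors G v"
      using G'(2,8) v by (auto simp: neighbors_def)
    then show ?thesis
      using k card_mono[OF finite_neighbors[OF G'(1)]] le_trans unfolding degree_def by blast
  qed
  moreover have "verts G \<noteq> {}"
    using ne G'(3) by auto
  ultimately show ?thesis
    using G'(5) by (simp add: min_degree_def)
qed

section \<open>Transport along sequences of Kelmans operations\<close>

lemma kelmans_steps_mono:
  assumes "feasible P" "kelmans_step\<^sup>*\<^sup>* G H" "simple_graph G"
  shows "P G \<le> P H"
  using assms(2)
proof induction
  case (step H J)
  obtain x y where xy: "x \<in> verts H" "y \<in> verts H" "x \<noteq> y" "J = kelmans H x y"
    using step(2) by (auto simp: kelmans_step_def)
  have "simple_graph H"
    using kelmans_steps_simple[OF step(1) assms(3)] by simp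
  then have "P H \<le> P J"
    using assms(1) xy by (auto simp: feasible_def)
  then show ?case
    using step(3) by simp
qed simp

text \<open>The invariant \<open>N\<close> travels forward along the sequence while the split form
  travels backward from its end; the induction is therefore at the front of the sequence, with
  \<open>N\<close> as a premise.\<close>

lemma split_form_of_kelmans_steps:
  assumes "kelmans_step\<^sup>*\<^sup>* G M" "N G"
    and K: "split_form M S A" "card S = t" "card A = a"
    and closed: "\<And>G x y. N G \<Longrightarrow> x \<in> verts G \<Longrightarrow> y \<in> verts G \<Longrightarrow> x \<noteq> y \<Longrightarrow> N (kelmans G x y)"
    and pull: "\<And>G x y S A. N G \<Longrightarrow> x \<in> verts G \<Longrightarrow> y \<in> verts G \<Longrightarrow> x \<noteq> y \<Longrightarrow>
      split_form (kelmans G x y) S A \<Longrightarrow> card S = t \<Longrightarrow> card A = a \<Longrightarrow>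
      \<exists>T B. split_form G T B \<and> card T = t \<and> card B = a"
  shows "\<exists>T B. split_form G T B \<and> card T = t \<and> card B = a"
  using assms(1,2)
proof (induction rule: converse_rtranclp_induct)
  case base
  then show ?case using K by blast
next
  case (step G H)
  then obtain x y where xy: "x \<in> verts G" "y \<in> verts G" "x \<noteq> y" "H = kelmans G x y"
    by (auto simp: kelmans_step_def)
  then have "N H"
    using closed step.prems by blast
  then obtain T B where "split_form H T B" "card T = t" "card B = a"
    using step.IH by blast
  then show ?case
    using pull[OF step.prems xy(1-3)] xy(4) by blast
qed

text \<open>The compressed graph \<open>M\<close> is a subgraph of a split graph isomorphic to
  \<open>H\<close>. If it is a proper one, adding the missing edges raises the parameter strictly;
  the condition t >= 1 makes the split graph connected. So equality forces \<open>M\<close> to be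
  the split graph, and its form is pulled back to \<open>G\<close>.\<close>

lemma param_le_split_form:
  assumes P: "graph_parameter P" "feasible P"
    and G: "simple_graph G" "A \<subseteq> verts G" "card A = a" "a + t \<le> card (verts G)" "t \<ge> 1"
    and deg: "\<And>v. v \<in> A \<Longrightarrow> degree G v \<le> t"
    and H: "split_form H T B" "card T = t" "card B = a" "card (verts H) = card (verts G)"
    and "N G"
    and closed: "\<And>G x y. N G \<Longrightarrow> x \<in> verts G \<Longrightarrow> y \<in> verts G \<Longrightarrow> x \<noteq> y \<Longrightarrow> N (kelmans G x y)"
    and pull: "\<And>G x y S A. N G \<Longrightarrow> x \<in> verts G \<Longrightarrow> y \<in> verts G \<Longrightarrow> x \<noteq> y \<Longrightarrow>
      split_form (kelmans G x y) S A \<Longrightarrow> card S = t \<Longrightarrow> card A = a \<Longrightarrow>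
      \<exists>T B. split_form G T B \<and> card T = t \<and> card B = a"
  shows "P G \<le> P H \<and> (P G = P H \<longrightarrow> graph_iso G H)"
proof -
  obtain M S where M: "kelmans_step\<^sup>*\<^sup>* G M" "S \<subseteq> verts G - A" "card S = t"
    "edges M \<subseteq> edges (split_graph (verts G) S A)"
    by (rule kelmans_steps_to_split[OF G(1,2) _ deg]) (use G in auto)
  let ?D = "split_graph (verts G) S A"
  have VM: "simple_graph M" "verts M = verts G"
    using kelmans_steps_simple[OF M(1) G(1)] by auto
  have D: "split_form ?D S A"
    by (rule split_form_split_graph) (use G M in \<open>auto simp: simple_graph_def\<close>)
  have VD: "verts ?D = verts G"
    by (simp add: split_graph_def)
  have "graph_iso ?D H"
    by (rule split_form_iso[OF D H(1)]) (use M G H VD in auto)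
  then have PD: "P ?D = P H"
    using P(1) split_formD(1)[OF D] split_formD(1)[OF H(1)] by (auto simp: graph_parameter_def)
  have GM: "P G \<le> P M"
    using kelmans_steps_mono[OF P(2) M(1) G(1)] .
  show ?thesis
  proof (cases "edges M = edges ?D")
    case True
    then have "M = ?D"
      using VM VD by (intro graph.expand) simp
    then have "split_form M S A"
      using D by simp
    then have "\<exists>T' B'. split_form G T' B' \<and> card T' = t \<and> card B' = a"
      by (rule split_form_of_kelmans_steps[where N = N, OF M(1) \<open>N G\<close> _ M(3) G(3)])
        (fact closed pull)+
    then have "graph_iso G H"
      using split_form_iso H by metis
    then show ?thesis
      using GM PD \<open>M = ?D\<close> by simp
  next
    case False
    let ?F = "edges ?D - edges M"
    have add: "add_edges M ?F = ?D"
      using M(4) VM VD by (intro graph.expand) (auto simp: add_edges_def)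
    have "connected_graph ?D"
      by (rule split_form_connected[OF D]) (use M G in auto)
    moreover have "?F \<noteq> {}"
      using False M(4) by blast
    moreover have "?F \<subseteq> [verts M]\<^bsup>2\<^esup> - edges M"
      using split_formD(1)[OF D] VM VD by (auto simp: simple_graph_def)
    ultimately have "P M < P ?D"
      using P(2) VM(1) add unfolding feasible_def by metis
    then show ?thesis
      using GM PD by simp
  qed
qed

text \<open>Witnesses against both inclusions are private neighbours of \<open>x\<close> and
  \<open>y\<close>, which would make \<open>G\<close> Hamiltonian.\<close>

lemma neighbors_nested_if_kelmans_split_form:
  assumes G: "simple_graph G" "\<not> hamiltonian G"
    and xy: "x \<in> verts G" "y \<in> verts G" "x \<noteq> y"
    and K: "split_form (kelmans G x y) S A" "card S = card A" "2 * card A < card (verts G)"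
  shows "(\<forall>w. adj G x w \<longrightarrow> w \<noteq> y \<longrightarrow> adj G y w) \<or> (\<forall>u. adj G y u \<longrightarrow> u \<noteq> x \<longrightarrow> adj G x u)"
proof -
  have "card (S \<union> A) \<le> card S + card A"
    by (rule card_Un_le)
  then have "S \<union> A \<noteq> verts G"
    using K by auto
  then show ?thesis
    using hamiltonian_if_kelmans_split_form[OF G(1) xy K(1,2)] G(2) by blast
qed

section \<open>The graphs H and L\<close>

lemma image_pair_iff:
  assumes "inj h"
  shows "{p, q} \<in> (`) h ` E \<longleftrightarrow> (\<exists>u v. p = h u \<and> q = h v \<and> {u, v} \<in> E)"
proof
  assume "{p, q} \<in> (`) h ` E"
  then obtain e where e: "e \<in> E" "{p, q} = h ` e" by blast
  then have "p \<in> h ` e" "q \<in> h ` e"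
    by (metis insertI1, metis insertI1 insert_commute)
  then obtain u v where uv: "p = h u" "q = h v" by blast
  then have "h ` e = h ` {u, v}"
    using e(2) by simp
  then have "e = {u, v}"
    using assms by (metis inj_image_eq_iff)
  then show "\<exists>u v. p = h u \<and> q = h v \<and> {u, v} \<in> E"
    using uv e(1) by blast
next
  assume "\<exists>u v. p = h u \<and> q = h v \<and> {u, v} \<in> E"
  then obtain u v where "p = h u" "q = h v" "{u, v} \<in> E" by blast
  then show "{p, q} \<in> (`) h ` E"
    by (intro image_eqI[of _ _ "{u, v}"]) auto
qed

lemma pair_in_nsets_iff: "{u, v} \<in> [X]\<^bsup>2\<^esup> \<longleftrightarrow> u \<in> X \<and> v \<in> X \<and> u \<noteq> v"
  by (auto simp: nsets_def card_insert_if)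

text \<open>Stated for arbitrary sets so that the comparison with the split form stays propositional
  when the sets are images under the vertex encodings.\<close>

lemma join_adjacency_cases:
  assumes "p \<in> S \<union> A \<union> K" "q \<in> S \<union> A \<union> K" "S \<inter> A = {}" "(S \<union> A) \<inter> K = {}"
  shows "(p \<in> S \<and> q \<in> S \<and> p \<noteq> q) \<or> (p \<in> K \<and> q \<in> K \<and> p \<noteq> q) \<or>
      (p \<in> S \<and> q \<in> A \<union> K) \<or> (q \<in> S \<and> p \<in> A \<union> K) \<longleftrightarrow>
    p \<noteq> q \<and> (p \<in> S \<or> q \<in> S \<or> p \<notin> A \<and> q \<notin> A)"
  using assms by auto

lemma split_form_join:
  obtains S A where
    "split_form (join (complete_graph t) (disjoint_union (edgeless_graph a) (complete_graph m))) S A"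
    "card S = t" "card A = a"
    "card (verts (join (complete_graph t) (disjoint_union (edgeless_graph a) (complete_graph m)))) =
      t + a + m"
proof -
  let ?G = "join (complete_graph t) (disjoint_union (edgeless_graph a) (complete_graph m))"
  define f :: "nat \<Rightarrow> nat" where "f v = 2 * v" for v
  define g :: "nat \<Rightarrow> nat" where "g v = Suc (2 * v)" for v
  have inj: "inj f" "inj g"
    by (auto simp: f_def g_def inj_def)
  have fg: "f u \<noteq> g v" "g v \<noteq> f u" "f u = f v \<longleftrightarrow> u = v" "g u = g v \<longleftrightarrow> u = v" for u v
    unfolding f_def g_def by presburger+
  have enc: "(\<lambda>v. sum_encode (Inl v)) = f" "(\<lambda>v. sum_encode (Inr v)) = g"
    by (auto simp: fun_eq_iff sum_encode_def f_def g_def)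
  \<comment> \<open>The edgeless part and the second clique are encoded twice: by the disjoint
    union, and then as the right side of the join.\<close>
  let ?S = "f ` {..<t}" and ?A = "g ` f ` {..<a}" and ?K = "g ` g ` {..<m}"
  have V: "verts ?G = ?S \<union> ?A \<union> ?K"
    by (simp add: join_def disjoint_union_def complete_graph_def edgeless_graph_def map_verts_def
        Let_def enc image_Un Un_assoc)
  have E: "adj ?G p q \<longleftrightarrow>
      (p \<in> ?S \<and> q \<in> ?S \<and> p \<noteq> q) \<or> (p \<in> ?K \<and> q \<in> ?K \<and> p \<noteq> q) \<or>
      (p \<in> ?S \<and> q \<in> ?A \<union> ?K) \<or> (q \<in> ?S \<and> p \<in> ?A \<union> ?K)" for p q
  proof -
    have 1: "{p, q} \<in> (`) f ` [{..<t}]\<^bsup>2\<^esup> \<longleftrightarrow> p \<in> ?S \<and> q \<in> ?S \<and> p \<noteq> q"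
      by (auto simp: image_pair_iff[OF inj(1)] pair_in_nsets_iff fg)
    have 2: "{p, q} \<in> (`) g ` (`) g ` [{..<m}]\<^bsup>2\<^esup> \<longleftrightarrow>
        p \<in> ?K \<and> q \<in> ?K \<and> p \<noteq> q"
      by (auto simp: image_pair_iff[OF inj(2)] pair_in_nsets_iff fg)
    have 3: "{p, q} \<in> {{x, y} |x y. x \<in> ?S \<and> y \<in> ?A \<union> ?K} \<longleftrightarrow>
        (p \<in> ?S \<and> q \<in> ?A \<union> ?K) \<or> (q \<in> ?S \<and> p \<in> ?A \<union> ?K)"
      unfolding mem_Collect_eq doubleton_eq_iff by blast
    have "edges ?G = (`) f ` [{..<t}]\<^bsup>2\<^esup> \<union> (`) g ` (`) g ` [{..<m}]\<^bsup>2\<^esup> \<union>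
        {{x, y} |x y. x \<in> ?S \<and> y \<in> ?A \<union> ?K}"
      by (simp add: join_def disjoint_union_def complete_graph_def edgeless_graph_def map_verts_def
          Let_def enc image_Un)
    then show ?thesis
      using 1 2 3 by (simp only: Un_iff disj_assoc)
  qed
  have disj: "?S \<inter> ?A = {}" "(?S \<union> ?A) \<inter> ?K = {}"
    using fg by auto
  have card: "card ?S = t" "card ?A = a" "card ?K = m"
    by (simp_all add: card_image inj_on_subset[OF inj(1) subset_UNIV] inj_on_subset[OF inj(2) subset_UNIV])
  have "adj ?G p q \<longleftrightarrow> p \<noteq> q \<and> (p \<in> ?S \<or> q \<in> ?S \<or> p \<notin> ?A \<and> q \<notin> ?A)"
    if "p \<in> verts ?G" "q \<in> verts ?G" for p q
    unfolding E using that[unfolded V] disj by (rule join_adjacency_cases)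
  moreover have "simple_graph ?G"
  proof (rule simple_graphI)
    show "finite (verts ?G)"
      unfolding V by simp
    fix e assume e: "e \<in> edges ?G"
    then have "\<exists>p q. e = {p, q}"
      by (auto simp: join_def disjoint_union_def complete_graph_def edgeless_graph_def map_verts_def
          Let_def nsets_def card_2_iff)
    then obtain p q where pq: "e = {p, q}" by blast
    then have "adj ?G p q"
      using e by simp
    then show "\<exists>u v. e = {u, v} \<and> u \<in> verts ?G \<and> v \<in> verts ?G \<and> u \<noteq> v"
      unfolding E V pq using fg by (intro exI[of _ p] exI[of _ q]) auto
  qed
  moreover have "?S \<subseteq> verts ?G" "?A \<subseteq> verts ?G"
    unfolding V by (rule le_supI1, rule Un_upper1, rule le_supI1, rule Un_upper2)
  ultimately have "split_form ?G ?S ?A"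
    unfolding split_form_def using disj(1) by (intro conjI ballI)
  moreover have "card (verts ?G) = t + a + m"
    unfolding V using disj card by (subst card_Un_disjoint; simp)+
  ultimately show ?thesis
    using that card by blast
qed

lemma split_form_H_graph:
  assumes "2 * s \<le> n"
  obtains S A where "split_form (H_graph n s) S A" "card S = s" "card A = s"
    "card (verts (H_graph n s)) = n"
  using split_form_join[of s s "n - 2 * s"] assms unfolding H_graph_def by auto

lemma split_form_L_graph:
  assumes "1 \<le> s" "2 * s \<le> n + 1"
  obtains S A where "split_form (L_graph n s) S A" "card S = s - 1" "card A = s"
    "card (verts (L_graph n s)) = n"
  using split_form_join[of "s - 1" s "n + 1 - 2 * s"] assms unfolding L_graph_def by auto

lemma H_graph_in_free_graphs:
  assumes "1 \<le> k" "k \<le> s" "2 * s + 1 \<le> n"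
  shows "H_graph n s \<in> free_graphs n (cycle_graph n) k"
proof -
  have "2 * s \<le> n"
    using assms by simp
  then obtain S A where G: "split_form (H_graph n s) S A" "card S = s" "card A = s"
    "card (verts (H_graph n s)) = n"
    by (rule split_form_H_graph)
  have ne: "A \<noteq> {}"
    using G assms by auto
  have rest: "S \<union> A \<noteq> verts (H_graph n s)"
    using G assms card_Un_le[of S A] by auto
  have "k \<le> min_degree (H_graph n s)"
    by (rule split_form_min_degree[OF G(1) ne _ rest]) (use G assms in simp)
  moreover have "\<not> hamiltonian (H_graph n s)"
    by (rule split_form_nonhamiltonian[OF G(1) _ ne rest]) (use G in simp)
  ultimately show ?thesis
    using G split_formD(1)[OF G(1)] assms contains_cycle_graph_iff[of "H_graph n s" n]
    by (simp add: free_graphs_def)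
qed

lemma L_graph_in_free_graphs:
  assumes "1 \<le> k" "k + 1 \<le> s" "2 * s \<le> n"
  shows "L_graph n s \<in> free_graphs n (path_graph n) k"
proof -
  have "1 \<le> s" "2 * s \<le> n + 1"
    using assms by simp_all
  then obtain S A where G: "split_form (L_graph n s) S A" "card S = s - 1" "card A = s"
    "card (verts (L_graph n s)) = n"
    by (rule split_form_L_graph)
  note G' = split_formD[OF G(1)]
  have ne: "A \<noteq> {}" "verts (L_graph n s) \<noteq> {}"
    using G assms by auto
  have rest: "S \<union> A \<noteq> verts (L_graph n s)"
    using G assms card_Un_le[of S A] by auto
  have deg: "k \<le> min_degree (L_graph n s)"
    by (rule split_form_min_degree[OF G(1) ne(1) _ rest]) (use G assms in simp)
  obtain z where z: "z \<notin> verts (L_graph n s)"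
    using ex_new_if_finite[OF infinite_UNIV_nat G'(5)] by blast
  have zS: "z \<notin> S" "z \<notin> A"
    using z G'(2,3) by auto
  \<comment> \<open>The cone has \<open>card S + 1 = card A\<close> dominating vertices and still a
    vertex outside both parts, so the argument for cycles excludes a Hamilton cycle and hence a
    Hamilton path below.\<close>
  have "\<not> hamiltonian (cone z (L_graph n s))"
  proof (rule split_form_nonhamiltonian[OF split_form_cone[OF G(1) z] _ ne(1)])
    show "card (insert z S) = card A"
      using G zS G'(6) assms by simp
    show "insert z S \<union> A \<noteq> verts (cone z (L_graph n s))"
      using rest z zS by auto
  qed
  then have "\<not> contains_copy (L_graph n s) (path_graph n)"
    using hamiltonian_cone_iff[OF G'(1) z ne(2)] contains_path_graph_iff[OF G'(1) G(4)] by blast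
  then show ?thesis
    using G G'(1) deg by (simp add: free_graphs_def)
qed

lemma min_degree_le_degree:
  assumes "simple_graph G" "v \<in> verts G" "k \<le> min_degree G"
  shows "k \<le> degree G v"
proof -
  have "min_degree G \<le> degree G v"
    unfolding min_degree_def using assms by (intro Min_le) (auto simp: simple_graph_def)
  then show ?thesis
    using assms(3) by simp
qed

lemma cycle_free_le_H_graph:
  assumes P: "graph_parameter P" "feasible P" and k: "1 \<le> k" "2 * k + 1 \<le> n"
    and "G \<in> free_graphs n (cycle_graph n) k"
  obtains s where "k \<le> s" "2 * s + 1 \<le> n" "P G \<le> P (H_graph n s)"
    "P G = P (H_graph n s) \<Longrightarrow> graph_iso G (H_graph n s)"
proof -
  have G: "simple_graph G" "card (verts G) = n" "k \<le> min_degree G"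
    and free: "\<not> contains_copy G (cycle_graph n)"
    using assms by (auto simp: free_graphs_def)
  have nh: "\<not> hamiltonian G"
    using free contains_cycle_graph_iff[OF G(1,2)] k by simp
  have "n \<ge> 3"
    using k by simp
  then obtain s A where s: "k \<le> s" "2 * s + 1 \<le> n" "A \<subseteq> verts G" "card A = s"
    "\<And>a. a \<in> A \<Longrightarrow> degree G a \<le> s"
    using nonhamiltonian_small_degrees[OF G(1,2) _ nh] min_degree_le_degree[OF G(1) _ G(3)]
    by metis
  have "2 * s \<le> n"
    using s by simp
  then obtain S B where H: "split_form (H_graph n s) S B" "card S = s" "card B = s"
    "card (verts (H_graph n s)) = n"
    by (rule split_form_H_graph)
  \<comment> \<open>The order is part of the invariant because both the preservation of
    non-Hamiltonicity and the pull-back need a lower bound on it.\<close>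
  let ?N = "\<lambda>G. simple_graph G \<and> card (verts G) = n \<and> \<not> hamiltonian G"
  have "P G \<le> P (H_graph n s) \<and> (P G = P (H_graph n s) \<longrightarrow> graph_iso G (H_graph n s))"
  proof (rule param_le_split_form[OF P G(1) s(3,4) _ _ s(5) H(1,2,3), where N = ?N])
    show "?N G"
      using G nh by blast
    show "?N (kelmans G x y)" if "?N G" "x \<in> verts G" "y \<in> verts G" "x \<noteq> y" for G x y
      using that hamiltonian_kelmans[of G x y] simple_graph_kelmans \<open>n \<ge> 3\<close> by auto
    show "\<exists>T B. split_form G T B \<and> card T = s \<and> card B = s"
      if N: "?N G" and xy: "x \<in> verts G" "y \<in> verts G" "x \<noteq> y"
        and K: "split_form (kelmans G x y) S A" "card S = s" "card A = s" for G x y S A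
    proof -
      have G: "simple_graph G"
        using N by blast
      have "(\<forall>w. adj G x w \<longrightarrow> w \<noteq> y \<longrightarrow> adj G y w) \<or> (\<forall>u. adj G y u \<longrightarrow> u \<noteq> x \<longrightarrow> adj G x u)"
        by (rule neighbors_nested_if_kelmans_split_form[OF _ _ xy K(1)]) (use N K s(2) in auto)
      from split_form_of_kelmans[OF G xy K(1) this] show ?thesis
        using K by metis
    qed
  qed (use s G H k in auto)
  then show ?thesis
    using that s by blast
qed

lemma path_free_le_L_graph:
  assumes P: "graph_parameter P" "feasible P" and k: "1 \<le> k" "2 * k + 2 \<le> n"
    and "G \<in> free_graphs n (path_graph n) k"
  obtains s where "k + 1 \<le> s" "2 * s \<le> n" "P G \<le> P (L_graph n s)"
    "P G = P (L_graph n s) \<Longrightarrow> graph_iso G (L_graph n s)"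
proof -
  have G: "simple_graph G" "card (verts G) = n" "k \<le> min_degree G"
    and free: "\<not> contains_copy G (path_graph n)"
    using assms by (auto simp: free_graphs_def)
  have fin: "finite (verts G)" and ne: "verts G \<noteq> {}"
    using G k by (auto simp: simple_graph_def)
  obtain z where z: "z \<notin> verts G"
    using ex_new_if_finite[OF infinite_UNIV_nat fin] by blast
  have nh: "\<not> hamiltonian (cone z G)"
    using free hamiltonian_cone_iff[OF G(1) z ne] contains_path_graph_iff[OF G(1,2)] by blast
  have C: "simple_graph (cone z G)" "card (verts (cone z G)) = n + 1"
    using simple_graph_cone[OF G(1) z] z fin G(2) by auto
  \<comment> \<open>The apex raises all degrees by one, which is why the range for paths starts at k
    + 1; the bound on the cone, which has n + 1 vertices, becomes 2 * s \<le> n.\<close>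
  have "k + 1 \<le> degree (cone z G) v" if "v \<in> verts (cone z G)" for v
    using that degree_cone[OF G(1) z] min_degree_le_degree[OF G(1) _ G(3)] G(2) k by auto
  moreover have "n + 1 \<ge> 3"
    using k by simp
  ultimately obtain s A where s: "k + 1 \<le> s" "2 * s + 1 \<le> n + 1" "A \<subseteq> verts (cone z G)"
    "card A = s" "\<And>a. a \<in> A \<Longrightarrow> degree (cone z G) a \<le> s"
    using nonhamiltonian_small_degrees[OF C _ nh] by metis
  \<comment> \<open>The apex has degree \<open>n\<close>, which exceeds \<open>s\<close>. The
    vertices of \<open>A\<close> therefore belong to \<open>G\<close>, where they lose one from
    their degree: the comparison runs with t = s - 1 and a = s.\<close>
  have "z \<notin> A"
    using s(5)[of z] degree_cone(2)[OF G(1) z] G(2) s(1,2) k by auto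
  then have A: "A \<subseteq> verts G"
    using s(3) by auto
  have deg: "degree G a \<le> s - 1" if "a \<in> A" for a
    using s(5)[OF that] degree_cone(1)[OF G(1) z, of a] A that by auto
  have "1 \<le> s" "2 * s \<le> n + 1"
    using s by simp_all
  then obtain S B where H: "split_form (L_graph n s) S B" "card S = s - 1" "card B = s"
    "card (verts (L_graph n s)) = n"
    by (rule split_form_L_graph)
  \<comment> \<open>Fixing the vertex set keeps the same \<open>z\<close> available as an apex for
    every graph in the sequence.\<close>
  let ?N = "\<lambda>H. simple_graph H \<and> verts H = verts G \<and> \<not> hamiltonian (cone z H)"
  have "P G \<le> P (L_graph n s) \<and> (P G = P (L_graph n s) \<longrightarrow> graph_iso G (L_graph n s))"
  proof (rule param_le_split_form[OF P G(1) A s(4) _ _ deg H(1,2,3), where N = ?N])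
    show "?N G"
      using G nh by blast
    show "?N (kelmans J x y)" if "?N J" "x \<in> verts J" "y \<in> verts J" "x \<noteq> y" for J x y
    proof -
      have J: "simple_graph J" "z \<notin> verts J" "card (verts (cone z J)) \<ge> 3"
        using that(1) C z k by auto
      have "\<not> hamiltonian (kelmans (cone z J) x y)"
        using hamiltonian_kelmans[OF simple_graph_cone[OF J(1,2)] J(3)] that by auto
      then show ?thesis
        using that simple_graph_kelmans[OF J(1) that(3), of x] kelmans_cone[OF J(1,2) that(2-4)] by simp
    qed
    show "\<exists>T B. split_form J T B \<and> card T = s - 1 \<and> card B = s"
      if N: "?N J" and xy: "x \<in> verts J" "y \<in> verts J" "x \<noteq> y"
        and K: "split_form (kelmans J x y) S A" "card S = s - 1" "card A = s" for J x y S A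
    proof -
      have J: "simple_graph J" "z \<notin> verts J"
        using N z by auto
      note J' = simple_graph_cone[OF J]
      have "split_form (kelmans (cone z J) x y) (insert z S) A"
        using split_form_cone[OF K(1)] kelmans_cone[OF J xy] J by simp
      moreover have "z \<notin> S" "finite S"
        using split_formD(2,6)[OF K(1)] J(2) by auto
      then have "card (insert z S) = card A"
        using K \<open>1 \<le> s\<close> by simp
      moreover have "2 * card A < card (verts (cone z J))"
        using N C K s(2) by auto
      moreover have "x \<in> verts (cone z J)" "y \<in> verts (cone z J)" "\<not> hamiltonian (cone z J)"
        using xy N by auto
      ultimately have dom: "(\<forall>w. adj (cone z J) x w \<longrightarrow> w \<noteq> y \<longrightarrow> adj (cone z J) y w) \<or>
          (\<forall>u. adj (cone z J) y u \<longrightarrow> u \<noteq> x \<longrightarrow> adj (cone z J) x u)"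
        using neighbors_nested_if_kelmans_split_form[OF J'] xy(3) by metis
      have xz: "x \<noteq> z" "y \<noteq> z"
        using xy J(2) by auto
      have nz: "w \<noteq> z" if "adj J v w" for v w
        using adjD(2)[OF J(1) that] J(2) by auto
      \<comment> \<open>Nestedness descends from the cone because neighbours in \<open>J\<close> are
        never the apex.\<close>
      have "(\<forall>w. adj J x w \<longrightarrow> w \<noteq> y \<longrightarrow> adj J y w) \<or> (\<forall>u. adj J y u \<longrightarrow> u \<noteq> x \<longrightarrow> adj J x u)"
        using dom adj_cone(1)[OF J xz(1)] adj_cone(1)[OF J xz(2)] nz by metis
      from split_form_of_kelmans[OF J(1) xy K(1) this] show ?thesis
        using K by metis
    qed
  qed (use s G H k in auto)
  then show ?thesis
    using that s by simp
qed

text \<open>The candidates are admissible and dominate every admissible graph, so both maxima agree.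
  An extremal graph lies between the maximum and some candidate, which must then attain the maximum
  too, and the equality clause identifies the two.\<close>

lemma extremal_family:
  fixes X :: "nat \<Rightarrow> nat graph"
  assumes P: "graph_parameter P" and T: "finite {s. T s}" "\<exists>s. T s"
    and X: "\<And>s. T s \<Longrightarrow> X s \<in> free_graphs n F k"
    and le: "\<And>G. G \<in> free_graphs n F k \<Longrightarrow>
      \<exists>s. T s \<and> P G \<le> P (X s) \<and> (P G = P (X s) \<longrightarrow> graph_iso G (X s))"
  shows "ex_param P n F k = Max {P (X s) |s. T s}"
    and "EX_param P n F k = {iso_class (X s) |s. T s \<and> P (X s) = ex_param P n F k}"
proof -
  let ?R = "{P (X s) |s. T s}" and ?F = "P ` free_graphs n F k"
  have fin: "finite ?F" "finite ?R"
    using finite_param_free_graphs[OF P] T(1) by auto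
  have "?R \<noteq> {}" "?R \<subseteq> ?F"
    using T(2) X by auto
  then have "Max ?R \<le> Max ?F"
    using fin by (intro Max_mono) auto
  moreover have "Max ?F \<le> Max ?R"
  proof (rule Max.boundedI[OF fin(1)])
    show "?F \<noteq> {}"
      using \<open>?R \<noteq> {}\<close> \<open>?R \<subseteq> ?F\<close> by blast
    fix r assume "r \<in> ?F"
    then obtain s where "T s" "r \<le> P (X s)"
      using le by blast
    moreover have "P (X s) \<le> Max ?R"
      using fin(2) \<open>T s\<close> by (intro Max_ge) auto
    ultimately show "r \<le> Max ?R" by simp
  qed
  ultimately show "ex_param P n F k = Max ?R"
    by (simp add: ex_param_def)
  show "EX_param P n F k = {iso_class (X s) |s. T s \<and> P (X s) = ex_param P n F k}"
  proof
    show "EX_param P n F k \<subseteq> {iso_class (X s) |s. T s \<and> P (X s) = ex_param P n F k}"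
    proof
      fix c assume "c \<in> EX_param P n F k"
      then obtain G where G: "c = iso_class G" "G \<in> free_graphs n F k" "P G = ex_param P n F k"
        by (auto simp: EX_param_def)
      then obtain s where s: "T s" "P G \<le> P (X s)" "P G = P (X s) \<longrightarrow> graph_iso G (X s)"
        using le by blast
      have "P (X s) \<le> ex_param P n F k"
        unfolding ex_param_def using fin(1) X[OF s(1)] by simp
      then have "P G = P (X s)"
        using s(2) G(3) by simp
      then show "c \<in> {iso_class (X s) |s. T s \<and> P (X s) = ex_param P n F k}"
        using G s iso_class_eq by force
    qed
    show "{iso_class (X s) |s. T s \<and> P (X s) = ex_param P n F k} \<subseteq> EX_param P n F k"
      using X by (auto simp: EX_param_def)
  qed
qed

theorem theorem1p4:
  fixes P :: "nat graph \<Rightarrow> real"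
  assumes "graph_parameter P" and "feasible P"
  shows "(\<forall>k n :: nat. k \<ge> 1 \<longrightarrow> n \<ge> 2 * k + 1 \<longrightarrow>
           ex_param P n (cycle_graph n) k = Max {P (H_graph n s) |s. k \<le> s \<and> s \<le> (n - 1) div 2} \<and>
           EX_param P n (cycle_graph n) k =
             {iso_class (H_graph n s) |s. k \<le> s \<and> s \<le> (n - 1) div 2 \<and>
                P (H_graph n s) = ex_param P n (cycle_graph n) k}) \<and>
         (\<forall>k n :: nat. k \<ge> 1 \<longrightarrow> n \<ge> 2 * k + 2 \<longrightarrow>
           ex_param P n (path_graph n) k = Max {P (L_graph n s) |s. k + 1 \<le> s \<and> s \<le> n div 2} \<and>
           EX_param P n (path_graph n) k =
             {iso_class (L_graph n s) |s. k + 1 \<le> s \<and> s \<le> n div 2 \<and>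
                P (L_graph n s) = ex_param P n (path_graph n) k})"
proof (intro conjI allI impI)
  fix k n :: nat
  assume k: "k \<ge> 1" "n \<ge> 2 * k + 1"
  let ?T = "\<lambda>s. k \<le> s \<and> s \<le> (n - 1) div 2"
  \<comment> \<open>Trades the truncating subtraction and division of the statement for a linear
    inequality, which is safe because \<open>n\<close> is positive.\<close>
  have T: "?T s \<longleftrightarrow> k \<le> s \<and> 2 * s + 1 \<le> n" for s
    using k by auto
  have le: "\<exists>s. ?T s \<and> P G \<le> P (H_graph n s) \<and>
      (P G = P (H_graph n s) \<longrightarrow> graph_iso G (H_graph n s))"
    if "G \<in> free_graphs n (cycle_graph n) k" for G
    unfolding T by (rule cycle_free_le_H_graph[OF assms k that]) blast
  have fin: "finite {s. ?T s}"
    by (rule finite_subset[of _ "{..n}"]) auto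
  have ex: "\<exists>s. ?T s"
    using k by auto
  have X: "H_graph n s \<in> free_graphs n (cycle_graph n) k" if "?T s" for s
    using that H_graph_in_free_graphs k(1) unfolding T by blast
  note fam = extremal_family[OF assms(1) fin ex X le]
  show "ex_param P n (cycle_graph n) k = Max {P (H_graph n s) |s. ?T s}"
    by (rule fam(1))
  show "EX_param P n (cycle_graph n) k = {iso_class (H_graph n s) |s. k \<le> s \<and> s \<le> (n - 1) div 2 \<and>
      P (H_graph n s) = ex_param P n (cycle_graph n) k}"
    using fam(2) by (simp only: conj_assoc)
next
  fix k n :: nat
  assume k: "k \<ge> 1" "n \<ge> 2 * k + 2"
  let ?T = "\<lambda>s. k + 1 \<le> s \<and> s \<le> n div 2"
  have T: "?T s \<longleftrightarrow> k + 1 \<le> s \<and> 2 * s \<le> n" for s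
    by auto
  have le: "\<exists>s. ?T s \<and> P G \<le> P (L_graph n s) \<and>
      (P G = P (L_graph n s) \<longrightarrow> graph_iso G (L_graph n s))"
    if "G \<in> free_graphs n (path_graph n) k" for G
    unfolding T by (rule path_free_le_L_graph[OF assms k that]) blast
  have fin: "finite {s. ?T s}"
    by (rule finite_subset[of _ "{..n}"]) auto
  have ex: "\<exists>s. ?T s"
    using k by auto
  have X: "L_graph n s \<in> free_graphs n (path_graph n) k" if "?T s" for s
    using that L_graph_in_free_graphs k(1) unfolding T by blast
  note fam = extremal_family[OF assms(1) fin ex X le]
  show "ex_param P n (path_graph n) k = Max {P (L_graph n s) |s. ?T s}"
    by (rule fam(1))
  show "EX_param P n (path_graph n) k = {iso_class (L_graph n s) |s. k + 1 \<le> s \<and> s \<le> n div 2 \<and>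
      P (L_graph n s) = ex_param P n (path_graph n) k}"
    using fam(2) by (simp only: conj_assoc)
qed

end
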